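(* Let $v$ be a traversing vector field on a compact connected smooth manifold $X$ with boundary, and let $f:X\to\mathbb R$ be a Lyapunov function for $v$, i.e. a smooth function with $df(v)>0$ on $X$. Then: (1) The pair $(v,f)$ generates a (topological) embedding $\alpha(v,f):X\to\mathcal T(v)\times\mathbb R$, $x\mapsto(\gamma_x,f(x))$. (2) For any smooth map $\beta:\mathcal T(v)\to\mathbb R^N$, the composite map $$A(v,f):X\xrightarrow{\ \alpha(v,f)\ }\mathcal T(v)\times\mathbb R\xrightarrow{\ \beta\times\mathrm{id}\ }\mathbb R^N\times\mathbb R$$ is smooth. (3) For any two smooth functions $f_1,f_2:X\to\mathbb R$ with $df_1(v)>0$ and $df_2(v)>0$, the embeddings $\alpha(v,f_1)$ and $\alpha(v,f_2)$ are isotopic through homeomorphisms (onto their images), i.e. they are joined by a continuous family of topological embeddings $X\to\mathcal T(v)\times\mathbb R$.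
   Context: A smooth vector field $v$ on $X$ is traversing if each $v$-trajectory is either a closed interval with both ends in $\partial X$ or a singleton in $\partial X$. The trajectory space $\mathcal T(v)$ is the quotient of $X$ obtained by collapsing each $v$-trajectory to a point, with the quotient topology, and $\Gamma:X\to\mathcal T(v)$ is the quotient map. For $x\in X$, $\gamma_x$ denotes the $v$-trajectory through $x$, regarded as a point of $\mathcal T(v)$. A function $h:\mathcal T(v)\to\mathbb R$ is called smooth if $h\circ\Gamma:X\to\mathbb R$ is smooth; a map $\beta:\mathcal T(v)\to\mathbb R^N$ is smooth if its $N$ components are smooth functions. *)

theory Defs
  imports "HOL-Analysis.Analysis"
begin

section \<open>Smooth maps on subsets of Euclidean space\<close>

text \<open>\<open>Ck_on k S f\<close> is meant for open \<open>S\<close>: all iterated directional derivatives of order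
  at most \<open>k\<close> exist (as Frechet derivatives) and are continuous.\<close>

primrec Ck_on ::
  "nat \<Rightarrow> 'e::euclidean_space set \<Rightarrow> ('e \<Rightarrow> 'c::real_normed_vector) \<Rightarrow> bool" where
  "Ck_on 0 S f \<longleftrightarrow> continuous_on S f"
| "Ck_on (Suc k) S f \<longleftrightarrow>
     (\<forall>x\<in>S. f differentiable (at x)) \<and>
     (\<forall>u. Ck_on k S (\<lambda>x. frechet_derivative f (at x) u))"

text \<open>Smoothness on a set that need not be open (relatively open subsets of a half-space below):
  near each point, \<open>f\<close> agrees on \<open>S\<close> with a smooth function on an open set.\<close>

definition smooth_on :: "'e::euclidean_space set \<Rightarrow> ('e \<Rightarrow> 'c::real_normed_vector) \<Rightarrow> bool" where
  "smooth_on S f \<longleftrightarrow>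
     (\<forall>x\<in>S. \<exists>T g. open T \<and> x \<in> T \<and> (\<forall>k. Ck_on k T g) \<and> (\<forall>y\<in>S \<inter> T. g y = f y))"


section \<open>Smooth manifolds with boundary\<close>

text \<open>The model is a closed half-space of the Euclidean space \<open>'e\<close>, whose dimension
  \<open>DIM('e)\<close> is the (positive) dimension of the manifold.\<close>

definition normal_dir :: "'e::euclidean_space" where
  "normal_dir = (SOME b. b \<in> Basis)"

definition half_space :: "'e::euclidean_space set" where
  "half_space = {p. 0 \<le> p \<bullet> normal_dir}"

type_synonym ('a, 'e) chart = "'a set \<times> ('a \<Rightarrow> 'e)"

abbreviation chart_dom :: "('a, 'e) chart \<Rightarrow> 'a set" where
  "chart_dom c \<equiv> fst c"

abbreviation chart_map :: "('a, 'e) chart \<Rightarrow> 'a \<Rightarrow> 'e" where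
  "chart_map c \<equiv> snd c"

abbreviation chart_inv :: "('a, 'e) chart \<Rightarrow> 'e \<Rightarrow> 'a" where
  "chart_inv c \<equiv> inv_into (chart_dom c) (chart_map c)"

abbreviation chart_image :: "('a, 'e) chart \<Rightarrow> 'e set" where
  "chart_image c \<equiv> chart_map c ` chart_dom c"

definition second_countable_space :: "'a topology \<Rightarrow> bool" where
  "second_countable_space X \<longleftrightarrow>
     (\<exists>\<B>. countable \<B> \<and> (\<forall>V\<in>\<B>. openin X V) \<and>
          (\<forall>U x. openin X U \<and> x \<in> U \<longrightarrow> (\<exists>V\<in>\<B>. x \<in> V \<and> V \<subseteq> U)))"

definition is_chart :: "'a topology \<Rightarrow> ('a, 'e::euclidean_space) chart \<Rightarrow> bool" where
  "is_chart X c \<longleftrightarrow>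
     openin X (chart_dom c) \<and>
     openin (top_of_set half_space) (chart_image c) \<and>
     homeomorphic_map (subtopology X (chart_dom c)) (top_of_set (chart_image c)) (chart_map c)"

text \<open>The atlas \<open>\<A>\<close> is not required to be maximal.\<close>

definition smooth_manifold_with_boundary ::
  "'a topology \<Rightarrow> ('a, 'e::euclidean_space) chart set \<Rightarrow> bool" where
  "smooth_manifold_with_boundary X \<A> \<longleftrightarrow>
     Hausdorff_space X \<and> second_countable_space X \<and>
     (\<forall>c\<in>\<A>. is_chart X c) \<and>
     topspace X = (\<Union>c\<in>\<A>. chart_dom c) \<and>
     (\<forall>c\<in>\<A>. \<forall>d\<in>\<A>.
        smooth_on (chart_map c ` (chart_dom c \<inter> chart_dom d)) (chart_map d \<circ> chart_inv c))"

definition manifold_boundary :: "('a, 'e::euclidean_space) chart set \<Rightarrow> 'a set" where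
  "manifold_boundary \<A> = {x. \<exists>c\<in>\<A>. x \<in> chart_dom c \<and> chart_map c x \<bullet> normal_dir = 0}"

definition smooth_map ::
  "('a, 'e::euclidean_space) chart set \<Rightarrow> ('a \<Rightarrow> 'c::real_normed_vector) \<Rightarrow> bool" where
  "smooth_map \<A> f \<longleftrightarrow> (\<forall>c\<in>\<A>. smooth_on (chart_image c) (f \<circ> chart_inv c))"


section \<open>Vector fields, integral curves and trajectories\<close>

text \<open>A tangent vector at \<open>x\<close> is given by its coordinate vectors in the charts around \<open>x\<close>, which
  are related by the derivatives of the transition maps; so \<open>v c x\<close> is the coordinate vector of
  the field at \<open>x\<close> in the chart \<open>c\<close>. It is relevant only for \<open>x \<in> chart_dom c\<close>. The derivatives
  are taken within relatively open subsets of the half-space, where they are unique also at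
  boundary points.\<close>

type_synonym ('a, 'e) vfield = "('a, 'e) chart \<Rightarrow> 'a \<Rightarrow> 'e"

definition smooth_vector_field ::
  "('a, 'e::euclidean_space) chart set \<Rightarrow> ('a, 'e) vfield \<Rightarrow> bool" where
  "smooth_vector_field \<A> v \<longleftrightarrow>
     (\<forall>c\<in>\<A>. smooth_on (chart_image c) (v c \<circ> chart_inv c)) \<and>
     (\<forall>c\<in>\<A>. \<forall>d\<in>\<A>. \<forall>x\<in>chart_dom c \<inter> chart_dom d.
        v d x = frechet_derivative (chart_map d \<circ> chart_inv c)
                  (at (chart_map c x) within chart_map c ` (chart_dom c \<inter> chart_dom d)) (v c x))"

text \<open>The value of \<open>df(v)\<close> at \<open>x\<close>, computed in the chart \<open>c\<close>.\<close>

definition dir_deriv ::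
  "('a, 'e::euclidean_space) vfield \<Rightarrow> ('a \<Rightarrow> real) \<Rightarrow> ('a, 'e) chart \<Rightarrow> 'a \<Rightarrow> real" where
  "dir_deriv v f c x =
     frechet_derivative (f \<circ> chart_inv c) (at (chart_map c x) within chart_image c) (v c x)"

definition lyapunov ::
  "('a, 'e::euclidean_space) chart set \<Rightarrow> ('a, 'e) vfield \<Rightarrow> ('a \<Rightarrow> real) \<Rightarrow> bool" where
  "lyapunov \<A> v f \<longleftrightarrow>
     smooth_map \<A> f \<and> (\<forall>c\<in>\<A>. \<forall>x\<in>chart_dom c. dir_deriv v f c x > 0)"

text \<open>Derivatives at endpoints of \<open>I\<close> are one-sided, and a one-point interval imposes no
  derivative condition.\<close>

definition integral_curve ::
  "'a topology \<Rightarrow> ('a, 'e::euclidean_space) chart set \<Rightarrow> ('a, 'e) vfield \<Rightarrow> real set \<Rightarrow>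
   (real \<Rightarrow> 'a) \<Rightarrow> bool" where
  "integral_curve X \<A> v I \<sigma> \<longleftrightarrow>
     is_interval I \<and> continuous_map (top_of_set I) X \<sigma> \<and>
     (\<forall>t\<in>I. \<forall>c\<in>\<A>. \<sigma> t \<in> chart_dom c \<longrightarrow>
        ((chart_map c \<circ> \<sigma>) has_vector_derivative v c (\<sigma> t)) (at t within I))"

text \<open>The union of all integral curves through \<open>x\<close>, i.e. the image of the maximal one.\<close>

definition trajectory ::
  "'a topology \<Rightarrow> ('a, 'e::euclidean_space) chart set \<Rightarrow> ('a, 'e) vfield \<Rightarrow> 'a \<Rightarrow> 'a set" where
  "trajectory X \<A> v x = {y. \<exists>I \<sigma>. integral_curve X \<A> v I \<sigma> \<and> x \<in> \<sigma> ` I \<and> y \<in> \<sigma> ` I}"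

definition traversing ::
  "'a topology \<Rightarrow> ('a, 'e::euclidean_space) chart set \<Rightarrow> ('a, 'e) vfield \<Rightarrow> bool" where
  "traversing X \<A> v \<longleftrightarrow>
     smooth_vector_field \<A> v \<and>
     (\<forall>x\<in>topspace X.
        (\<exists>a b \<sigma>. a < b \<and> integral_curve X \<A> v {a..b} \<sigma> \<and>
           embedding_map (top_of_set {a..b}) X \<sigma> \<and> \<sigma> ` {a..b} = trajectory X \<A> v x \<and>
           \<sigma> a \<in> manifold_boundary \<A> \<and> \<sigma> b \<in> manifold_boundary \<A>) \<or>
        (trajectory X \<A> v x = {x} \<and> x \<in> manifold_boundary \<A>))"


section \<open>The trajectory space\<close>

text \<open>Points of the trajectory space are the trajectories, so the quotient map is
  \<open>trajectory X \<A> v\<close>; the topology is the quotient topology.\<close>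

definition trajectory_space ::
  "'a topology \<Rightarrow> ('a, 'e::euclidean_space) chart set \<Rightarrow> ('a, 'e) vfield \<Rightarrow> 'a set topology" where
  "trajectory_space X \<A> v =
     topology (\<lambda>W. W \<subseteq> trajectory X \<A> v ` topspace X \<and>
                   openin X {x \<in> topspace X. trajectory X \<A> v x \<in> W})"

lemma openin_trajectory_space:
  "openin (trajectory_space X \<A> v) W \<longleftrightarrow>
     W \<subseteq> trajectory X \<A> v ` topspace X \<and> openin X {x \<in> topspace X. trajectory X \<A> v x \<in> W}"
proof -
  let ?q = "trajectory X \<A> v"
  let ?P = "\<lambda>W. W \<subseteq> ?q ` topspace X \<and> openin X {x \<in> topspace X. ?q x \<in> W}"
  have "istopology ?P"
    unfolding istopology_def
  proof (intro conjI allI impI)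
    fix S T assume S: "?P S" and T: "?P T"
    show "S \<inter> T \<subseteq> ?q ` topspace X" using S by blast
    have "{x \<in> topspace X. ?q x \<in> S \<inter> T}
        = {x \<in> topspace X. ?q x \<in> S} \<inter> {x \<in> topspace X. ?q x \<in> T}" by blast
    then show "openin X {x \<in> topspace X. ?q x \<in> S \<inter> T}" using S T by auto
  next
    fix K assume K: "\<forall>S\<in>K. ?P S"
    show "\<Union>K \<subseteq> ?q ` topspace X" using K by blast
    have "{x \<in> topspace X. ?q x \<in> \<Union>K} = (\<Union>S\<in>K. {x \<in> topspace X. ?q x \<in> S})" by blast
    then show "openin X {x \<in> topspace X. ?q x \<in> \<Union>K}" using K by auto
  qed
  then show ?thesis
    unfolding trajectory_space_def by simp
qed

lemma topspace_trajectory_space: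
  "topspace (trajectory_space X \<A> v) = trajectory X \<A> v ` topspace X"
proof -
  have "{x \<in> topspace X. trajectory X \<A> v x \<in> trajectory X \<A> v ` topspace X} = topspace X"
    by blast
  then have "openin (trajectory_space X \<A> v) (trajectory X \<A> v ` topspace X)"
    by (simp add: openin_trajectory_space)
  moreover have "topspace (trajectory_space X \<A> v) \<subseteq> trajectory X \<A> v ` topspace X"
    using openin_topspace openin_trajectory_space by metis
  ultimately show ?thesis
    using openin_subset by blast
qed

lemma quotient_map_trajectory:
  "quotient_map X (trajectory_space X \<A> v) (trajectory X \<A> v)"
  by (auto simp: quotient_map_def topspace_trajectory_space openin_trajectory_space)

text \<open>A function on the trajectory space is smooth iff its pullback along the quotient map is;
  a map to \<open>\<real>\<^sup>N\<close> is smooth iff its components are.\<close>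

definition smooth_traj_fun ::
  "'a topology \<Rightarrow> ('a, 'e::euclidean_space) chart set \<Rightarrow> ('a, 'e) vfield \<Rightarrow>
   ('a set \<Rightarrow> real) \<Rightarrow> bool" where
  "smooth_traj_fun X \<A> v h \<longleftrightarrow> smooth_map \<A> (h \<circ> trajectory X \<A> v)"

definition smooth_traj_map ::
  "'a topology \<Rightarrow> ('a, 'e::euclidean_space) chart set \<Rightarrow> ('a, 'e) vfield \<Rightarrow>
   ('a set \<Rightarrow> real ^ 'N) \<Rightarrow> bool" where
  "smooth_traj_map X \<A> v \<beta> \<longleftrightarrow> (\<forall>i. smooth_traj_fun X \<A> v (\<lambda>\<gamma>. \<beta> \<gamma> $ i))"

definition alpha ::
  "'a topology \<Rightarrow> ('a, 'e::euclidean_space) chart set \<Rightarrow> ('a, 'e) vfield \<Rightarrow>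
   ('a \<Rightarrow> real) \<Rightarrow> 'a \<Rightarrow> 'a set \<times> real" where
  "alpha X \<A> v f x = (trajectory X \<A> v x, f x)"

abbreviation alpha_target ::
  "'a topology \<Rightarrow> ('a, 'e::euclidean_space) chart set \<Rightarrow> ('a, 'e) vfield \<Rightarrow>
   ('a set \<times> real) topology" where
  "alpha_target X \<A> v \<equiv> prod_topology (trajectory_space X \<A> v) euclideanreal"

text \<open>Two maps are isotopic if they are joined by a homotopy through embeddings.\<close>

definition isotopic_embeddings ::
  "'a topology \<Rightarrow> 'b topology \<Rightarrow> ('a \<Rightarrow> 'b) \<Rightarrow> ('a \<Rightarrow> 'b) \<Rightarrow> bool" where
  "isotopic_embeddings X Y = homotopic_with (embedding_map X Y) X Y"

end

theory Submission
  imports Defs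
begin

text \<open>The map \<open>x \<mapsto> (\<gamma>\<^sub>x, f x)\<close> is continuous, and it is injective because \<open>f\<close> strictly increases along
  trajectories. Since \<open>X\<close> is compact, it is an embedding as soon as the trajectory space is
  Hausdorff, i.e. as soon as lying on a common trajectory is a closed relation. The durations of
  trajectories are bounded, because \<open>df(v)\<close> has a positive lower bound, so after rescaling time all
  pieces of trajectories become curves \<open>\<tau>: [0,1] \<rightarrow> X\<close> with \<open>\<tau>' = S v(\<tau>)\<close> and \<open>S\<close> in a fixed interval
  \<open>[0,M]\<close>. The pairs \<open>(S, \<tau>)\<close> form a closed subset of \<open>[0,M] \<times> X\<^bsup>[0,1]\<^esup>\<close> with the topology of pointwise
  convergence, which is compact by Tychonoff's theorem, and the relation is essentially its image
  under evaluation at the end points. Uniqueness of integral curves is not needed: the traversing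
  condition already forces trajectories that meet to coincide. The isotopy is \<open>(1 - s) f\<^sub>1 + s f\<^sub>2\<close>.\<close>

section \<open>Smooth functions\<close>

lemma Ck_on_subset: "Ck_on k S f \<Longrightarrow> T \<subseteq> S \<Longrightarrow> Ck_on k T f"
  by (induction k arbitrary: f) (auto intro: continuous_on_subset)

text \<open>Openness of \<open>S\<close> makes \<open>f\<close> and \<open>g\<close> agree near each
  point, so their derivatives coincide on \<open>S\<close> and the induction passes to them. It is
  needed because derivatives of sums and composites are identified on \<open>S\<close> only.\<close>

lemma Ck_on_cong:
  assumes "open S" "\<And>x. x \<in> S \<Longrightarrow> f x = g x" "Ck_on k S f"
  shows "Ck_on k S g"
  using assms(2,3)
proof (induction k arbitrary: f g)
  case 0
  then show ?case by (simp cong: continuous_on_cong)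
next
  case (Suc k)
  have D: "(g has_derivative frechet_derivative f (at x)) (at x)" if "x \<in> S" for x
  proof -
    have "(f has_derivative frechet_derivative f (at x)) (at x)"
      using Suc.prems(2) that by (simp add: frechet_derivative_works[symmetric])
    then show ?thesis
      by (rule has_derivative_transform_within_open[OF _ assms(1) that]) (fact Suc.prems(1))
  qed
  then have "frechet_derivative f (at x) = frechet_derivative g (at x)" if "x \<in> S" for x
    using that frechet_derivative_at by blast
  then have "Ck_on k S (\<lambda>x. frechet_derivative g (at x) u)" for u
    using Suc.IH[of "\<lambda>x. frechet_derivative f (at x) u"] Suc.prems(2) by simp
  then show ?case using D unfolding Ck_on.simps differentiable_def by blast
qed

text \<open>The derivative of the composite is \<open>L\<close> applied to the derivative of
  \<open>f\<close>, which has the same shape as the composite itself, so induction on the order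
  applies.\<close>

lemma Ck_on_bounded_linear:
  assumes "bounded_linear L" "open S" "Ck_on k S f"
  shows "Ck_on k S (\<lambda>x. L (f x))"
  using assms(3)
proof (induction k arbitrary: f)
  case 0
  then show ?case using bounded_linear.continuous_on[OF assms(1)] by simp
next
  case (Suc k)
  have D: "((\<lambda>x. L (f x)) has_derivative (\<lambda>u. L (frechet_derivative f (at x) u))) (at x)"
    if "x \<in> S" for x
    using Suc.prems that frechet_derivative_works
    by (intro bounded_linear.has_derivative[OF assms(1)]) auto
  then have E: "(\<lambda>u. L (frechet_derivative f (at x) u)) = frechet_derivative (\<lambda>x. L (f x)) (at x)"
    if "x \<in> S" for x
    using that frechet_derivative_at by blast
  have "Ck_on k S (\<lambda>x. frechet_derivative (\<lambda>x. L (f x)) (at x) u)" for u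
  proof (rule Ck_on_cong[OF assms(2)])
    show "Ck_on k S (\<lambda>x. L (frechet_derivative f (at x) u))"
      using Suc by simp
  qed (simp add: E[symmetric])
  then show ?case using D unfolding Ck_on.simps differentiable_def by blast
qed

lemma Ck_on_add:
  assumes "open S" "Ck_on k S f" "Ck_on k S g"
  shows "Ck_on k S (\<lambda>x. f x + g x)"
  using assms(2,3)
proof (induction k arbitrary: f g)
  case 0
  then show ?case by (simp add: continuous_on_add)
next
  case (Suc k)
  let ?D = "\<lambda>x u. frechet_derivative f (at x) u + frechet_derivative g (at x) u"
  have D: "((\<lambda>x. f x + g x) has_derivative ?D x) (at x)" if "x \<in> S" for x
    using Suc.prems that frechet_derivative_works by (intro has_derivative_add) auto
  then have E: "?D x = frechet_derivative (\<lambda>x. f x + g x) (at x)" if "x \<in> S" for x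
    using that frechet_derivative_at by blast
  have "Ck_on k S (\<lambda>x. frechet_derivative (\<lambda>x. f x + g x) (at x) u)" for u
  proof (rule Ck_on_cong[OF assms(1)])
    show "Ck_on k S (\<lambda>x. ?D x u)"
      using Suc by simp
  qed (simp add: E[symmetric])
  then show ?case using D unfolding Ck_on.simps differentiable_def by blast
qed

lemma Ck_on_zero: "Ck_on k S (\<lambda>x. 0)"
  by (induction k) auto

lemma smooth_on_bounded_linear:
  assumes "bounded_linear L" "smooth_on S f"
  shows "smooth_on S (\<lambda>x. L (f x))"
  unfolding smooth_on_def
proof
  fix x assume "x \<in> S"
  then obtain T g where "open T" "x \<in> T" "\<forall>k. Ck_on k T g" "\<forall>y\<in>S \<inter> T. g y = f y"
    using assms(2) unfolding smooth_on_def by blast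
  then show "\<exists>T g. open T \<and> x \<in> T \<and> (\<forall>k. Ck_on k T g) \<and> (\<forall>y\<in>S \<inter> T. g y = L (f y))"
    by (intro exI[of _ T] exI[of _ "\<lambda>x. L (g x)"]) (auto intro: Ck_on_bounded_linear[OF assms(1)])
qed

lemma smooth_on_add:
  assumes "smooth_on S f" "smooth_on S g"
  shows "smooth_on S (\<lambda>x. f x + g x)"
  unfolding smooth_on_def
proof
  fix x assume x: "x \<in> S"
  obtain T f' where T: "open T" "x \<in> T" "\<forall>k. Ck_on k T f'" "\<forall>y\<in>S \<inter> T. f' y = f y"
    using assms(1) x unfolding smooth_on_def by blast
  obtain U g' where U: "open U" "x \<in> U" "\<forall>k. Ck_on k U g'" "\<forall>y\<in>S \<inter> U. g' y = g y"
    using assms(2) x unfolding smooth_on_def by blast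
  have "Ck_on k (T \<inter> U) (\<lambda>x. f' x + g' x)" for k
    using T U by (intro Ck_on_add) (auto intro: Ck_on_subset)
  then show "\<exists>T h. open T \<and> x \<in> T \<and> (\<forall>k. Ck_on k T h) \<and> (\<forall>y\<in>S \<inter> T. h y = f y + g y)"
    using T U by (intro exI[of _ "T \<inter> U"] exI[of _ "\<lambda>x. f' x + g' x"]) auto
qed

lemma smooth_on_sum:
  assumes "finite I" "\<And>i. i \<in> I \<Longrightarrow> smooth_on S (f i)"
  shows "smooth_on S (\<lambda>x. \<Sum>i\<in>I. f i x)"
  using assms
proof (induction I rule: finite_induct)
  case empty
  show ?case
    unfolding smooth_on_def
    by (intro ballI exI[of _ UNIV] exI[of _ "\<lambda>x. 0"]) (auto intro: Ck_on_zero)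
qed (simp add: smooth_on_add)

text \<open>The pair is a finite sum of scalar functions, each followed by a bounded linear
  embedding along a coordinate axis. This is what turns componentwise smoothness of \<beta> into
  smoothness of the composite in claim (2).\<close>

lemma smooth_on_vec_Pair:
  fixes g :: "'e::euclidean_space \<Rightarrow> real ^ 'n" and h :: "'e \<Rightarrow> real"
  assumes "\<And>i. smooth_on S (\<lambda>x. g x $ i)" "smooth_on S h"
  shows "smooth_on S (\<lambda>x. (g x, h x))"
proof -
  have "bounded_linear (\<lambda>r::real. (r *\<^sub>R axis i 1, 0) :: (real ^ 'n) \<times> real)" for i
    by (intro bounded_linear_intros)
  then have "smooth_on S (\<lambda>x. ((g x $ i) *\<^sub>R axis i 1, 0) :: (real ^ 'n) \<times> real)" for i
    using smooth_on_bounded_linear assms(1) by blast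
  moreover have "bounded_linear (\<lambda>r::real. (0, r) :: (real ^ 'n) \<times> real)"
    by (intro bounded_linear_intros)
  then have "smooth_on S (\<lambda>x. (0, h x) :: (real ^ 'n) \<times> real)"
    using smooth_on_bounded_linear assms(2) by blast
  ultimately have "smooth_on S (\<lambda>x. (\<Sum>i\<in>UNIV. ((g x $ i) *\<^sub>R axis i 1, 0)) + (0, h x) :: (real ^ 'n) \<times> real)"
    by (intro smooth_on_add smooth_on_sum) auto
  moreover have "(\<Sum>i\<in>UNIV. ((g x $ i) *\<^sub>R axis i 1, 0)) + (0, h x) = (g x, h x)" for x
    by (simp add: prod_eq_iff fst_sum snd_sum basis_expansion[of "g x", unfolded scalar_mult_eq_scaleR])
  ultimately show ?thesis by simp
qed

lemma smooth_on_imp_continuous_on: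
  assumes "smooth_on S f"
  shows "continuous_on S f"
proof (rule continuous_on_eq_continuous_within[THEN iffD2], rule)
  fix x assume x: "x \<in> S"
  obtain T g where T: "open T" "x \<in> T" "\<forall>k. Ck_on k T g" "\<forall>y\<in>S \<inter> T. g y = f y"
    using assms x unfolding smooth_on_def by blast
  have "continuous_on T g" using T(3)[rule_format, of 0] by simp
  then have "continuous_on (S \<inter> T) f"
    using T(4) by (metis (mono_tags) Int_lower2 continuous_on_cong continuous_on_subset)
  then have "continuous (at x within S \<inter> T) f"
    using x T(2) by (simp add: continuous_on_eq_continuous_within)
  moreover have "at x within S \<inter> T = at x within S"
    by (rule at_within_nhd[OF T(2,1)]) auto
  ultimately show "continuous (at x within S) f" by simp
qed

section \<open>Charts and integral curves in a chart\<close>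

lemma closed_half_space: "closed (half_space :: 'e::euclidean_space set)"
  unfolding half_space_def by (intro closed_Collect_le continuous_intros)

lemma chart_continuous_map:
  assumes "is_chart X c"
  shows "continuous_map (subtopology X (chart_dom c)) euclidean (chart_map c)"
  using assms homeomorphic_imp_continuous_map continuous_map_into_fulltopology
  unfolding is_chart_def by blast

lemma topspace_chart_dom:
  assumes "is_chart X c"
  shows "topspace (subtopology X (chart_dom c)) = chart_dom c"
proof -
  have "chart_dom c \<subseteq> topspace X"
    using assms openin_subset unfolding is_chart_def by blast
  then show ?thesis by (simp add: inf_absorb2)
qed

lemma chart_inj_on:
  assumes "is_chart X c"
  shows "inj_on (chart_map c) (chart_dom c)"
  using assms homeomorphic_imp_injective_map topspace_chart_dom unfolding is_chart_def by metis

lemma chart_openin_vimage: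
  assumes "is_chart X c" "open V"
  shows "openin X {x \<in> chart_dom c. chart_map c x \<in> V}"
proof -
  have D: "openin X (chart_dom c)" using assms(1) by (simp add: is_chart_def)
  have "openin (subtopology X (chart_dom c)) {x \<in> chart_dom c. chart_map c x \<in> V}"
    using openin_continuous_map_preimage[OF chart_continuous_map[OF assms(1)], of V]
    unfolding topspace_chart_dom[OF assms(1)] using assms(2) by simp
  then show ?thesis using D openin_trans_full by blast
qed

text \<open>A homeomorphism comes with some continuous inverse; injectivity identifies it on the
  image with the inverse \<open>inv_into\<close> used for charts.\<close>

lemma chart_inv_continuous_map:
  assumes "is_chart X c"
  shows "continuous_map (top_of_set (chart_image c)) (subtopology X (chart_dom c)) (chart_inv c)"
proof -
  obtain g where g: "homeomorphic_maps (subtopology X (chart_dom c)) (top_of_set (chart_image c))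
                       (chart_map c) g"
    using assms unfolding is_chart_def homeomorphic_map_maps by blast
  have sub: "chart_dom c \<subseteq> topspace X"
    using assms openin_subset unfolding is_chart_def by blast
  have "g y = chart_inv c y" if "y \<in> topspace (top_of_set (chart_image c))" for y
  proof -
    obtain x where x: "x \<in> chart_dom c" "y = chart_map c x" using \<open>y \<in> _\<close> by auto
    then have "g y = x" using g sub unfolding homeomorphic_maps_def by auto
    then show ?thesis using x chart_inj_on[OF assms] by simp
  qed
  then show ?thesis
    using g unfolding homeomorphic_maps_def by (metis continuous_map_eq)
qed

lemma chart_ball_subset_image:
  assumes "is_chart X c" "p \<in> chart_dom c"
  obtains r where "r > 0" "cball (chart_map c p) r \<inter> half_space \<subseteq> chart_image c"
  using assms unfolding is_chart_def openin_contains_cball by blast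

text \<open>The set is the image under the inverse chart of a compact piece of the half-space, hence
  compact, hence closed in all of the Hausdorff space \<open>X\<close> and not merely in the chart
  domain. This prevents curves and limits of curves from leaving the chart unnoticed.\<close>

lemma chart_cball_closedin:
  assumes "is_chart X c" "Hausdorff_space X" "cball q r \<inter> half_space \<subseteq> chart_image c"
  shows "closedin X {x \<in> chart_dom c. chart_map c x \<in> cball q r}"
proof -
  let ?K = "cball q r \<inter> half_space"
  have img: "chart_image c \<subseteq> half_space"
    using assms(1) openin_imp_subset unfolding is_chart_def by blast
  have "compact ?K"
    by (intro compact_Int_closed compact_cball closed_half_space)
  then have "compactin (top_of_set (chart_image c)) ?K"
    using assms(3) by (simp add: compactin_subtopology)
  moreover have "continuous_map (top_of_set (chart_image c)) X (chart_inv c)"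
    using chart_inv_continuous_map[OF assms(1)] continuous_map_into_fulltopology by blast
  ultimately have "compactin X (chart_inv c ` ?K)"
    using image_compactin by blast
  moreover have "chart_inv c ` ?K = {x \<in> chart_dom c. chart_map c x \<in> cball q r}"
  proof (intro set_eqI iffI)
    fix x assume "x \<in> chart_inv c ` ?K"
    then show "x \<in> {x \<in> chart_dom c. chart_map c x \<in> cball q r}"
      using assms(3) by (auto simp: inv_into_into f_inv_into_f)
  next
    fix x assume "x \<in> {x \<in> chart_dom c. chart_map c x \<in> cball q r}"
    then show "x \<in> chart_inv c ` ?K"
      using img chart_inj_on[OF assms(1)] by (intro image_eqI[of _ _ "chart_map c x"]) auto
  qed
  ultimately show ?thesis using assms(2) compactin_imp_closedin by metis
qed

lemma chart_limitin:
  assumes "is_chart X c" "limitin X g l F" "l \<in> chart_dom c"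
  shows "eventually (\<lambda>i. g i \<in> chart_dom c) F" "((\<lambda>i. chart_map c (g i)) \<longlongrightarrow> chart_map c l) F"
proof -
  show "eventually (\<lambda>i. g i \<in> chart_dom c) F"
    using assms unfolding limitin_def is_chart_def by blast
  show "((\<lambda>i. chart_map c (g i)) \<longlongrightarrow> chart_map c l) F"
  proof (rule topological_tendstoI)
    fix V assume "open V" "chart_map c l \<in> V"
    then have "eventually (\<lambda>i. g i \<in> {x \<in> chart_dom c. chart_map c x \<in> V}) F"
      using chart_openin_vimage[OF assms(1)] assms(2,3) unfolding limitin_def by blast
    then show "eventually (\<lambda>i. chart_map c (g i) \<in> V) F"
      by (rule eventually_mono) simp
  qed
qed

section \<open>Curves reparametrised over the unit interval\<close>

definition rescaled_curve ::
  "'a topology \<Rightarrow> ('a, 'e::euclidean_space) chart set \<Rightarrow> ('a, 'e) vfield \<Rightarrow> real \<Rightarrow>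
   (real \<Rightarrow> 'a) \<Rightarrow> bool" where
  "rescaled_curve X \<A> v S \<tau> \<longleftrightarrow>
     continuous_map (top_of_set {0..1}) X \<tau> \<and>
     (\<forall>t\<in>{0..1}. \<forall>c\<in>\<A>. \<tau> t \<in> chart_dom c \<longrightarrow>
        ((chart_map c \<circ> \<tau>) has_vector_derivative S *\<^sub>R v c (\<tau> t)) (at t within {0..1}))"

text \<open>While the curve stays in the coordinate ball of radius \<open>r\<close>, its velocity
  differs from \<open>S *\<^sub>R w\<close> by at most \<open>M * \<epsilon>\<close> and has norm at
  most \<open>M * (norm w + \<epsilon>)\<close>. Starting in the ball of half the radius, it has no
  time to get out before \<open>t\<close>. The range of admissible \<open>t\<close> depends on the
  curve only through the bound \<open>M\<close>, so it is uniform over a family of curves.\<close>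

lemma rescaled_curve_estimate:
  fixes w :: "'e::euclidean_space"
  assumes X: "Hausdorff_space X" and c: "c \<in> \<A>" "is_chart X c"
    and \<tau>: "rescaled_curve X \<A> v S \<tau>" and S: "0 \<le> S" "S \<le> M"
    and sub: "cball q r \<inter> half_space \<subseteq> chart_image c"
    and near: "\<And>x. x \<in> chart_dom c \<Longrightarrow> chart_map c x \<in> cball q r \<Longrightarrow> norm (v c x - w) \<le> \<epsilon>"
    and t: "t0 \<in> {0..1}" "t \<in> {0..1}" and small: "M * (norm w + \<epsilon>) * \<bar>t - t0\<bar> < r / 2"
    and start: "\<tau> t0 \<in> chart_dom c" "chart_map c (\<tau> t0) \<in> ball q (r / 2)"
  shows "\<tau> t \<in> chart_dom c \<and> chart_map c (\<tau> t) \<in> cball q r \<and>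
    norm (chart_map c (\<tau> t) - chart_map c (\<tau> t0) - ((t - t0) * S) *\<^sub>R w) \<le> M * \<epsilon> * \<bar>t - t0\<bar>"
proof -
  let ?\<phi> = "chart_map c"
  define N where "N = {x \<in> chart_dom c. ?\<phi> x \<in> cball q r}"
  define U where "U = {x \<in> chart_dom c. ?\<phi> x \<in> ball q r}"
  have N: "closedin X N" unfolding N_def by (rule chart_cball_closedin[OF c(2) X sub])
  have U: "openin X U" unfolding U_def by (rule chart_openin_vimage[OF c(2)]) simp
  have UN: "U \<subseteq> N" unfolding U_def N_def by auto
  have r: "0 < r" using start(2) by (metis ball_eq_empty empty_iff linorder_not_le half_gt_zero_iff)
  have t0U: "\<tau> t0 \<in> U" using start r unfolding U_def by auto
  have \<epsilon>: "0 \<le> \<epsilon>" using near[of "\<tau> t0"] t0U unfolding U_def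
    by (metis (no_types, lifting) ball_subset_cball mem_Collect_eq norm_ge_zero order_trans subsetD)
  \<comment> \<open>Mean value inequality for the curve minus the straight motion with velocity
    \<open>S *\<^sub>R w\<close>, valid as long as the curve remains in \<open>N\<close>.\<close>
  have est: "norm (?\<phi> (\<tau> s) - ?\<phi> (\<tau> t0) - ((s - t0) * S) *\<^sub>R w) \<le> M * \<epsilon> * \<bar>s - t0\<bar>"
    if s: "s \<in> {0..1}" and inN: "\<tau> ` closed_segment t0 s \<subseteq> N" for s
  proof -
    let ?I = "closed_segment t0 s"
    have I: "?I \<subseteq> {0..1}" using s t(1) by (simp add: closed_segment_subset)
    let ?g = "\<lambda>u. (?\<phi> \<circ> \<tau>) u - (u * S) *\<^sub>R w"
    have "norm (?g s - ?g t0) \<le> (M * \<epsilon>) * norm (s - t0)"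
    proof (rule differentiable_bound[of ?I ?g "\<lambda>u h. h *\<^sub>R (S *\<^sub>R v c (\<tau> u) - S *\<^sub>R w)"])
      fix u assume u: "u \<in> ?I"
      then have uN: "\<tau> u \<in> chart_dom c" "?\<phi> (\<tau> u) \<in> cball q r" using inN unfolding N_def by auto
      then have "((?\<phi> \<circ> \<tau>) has_vector_derivative S *\<^sub>R v c (\<tau> u)) (at u within ?I)"
        using \<tau> c(1) u I has_vector_derivative_within_subset unfolding rescaled_curve_def by blast
      moreover have "((\<lambda>u. (u * S) *\<^sub>R w) has_vector_derivative S *\<^sub>R w) (at u within ?I)"
        by (auto intro!: derivative_eq_intros simp: has_vector_derivative_def)
      ultimately have "(?g has_vector_derivative (S *\<^sub>R v c (\<tau> u) - S *\<^sub>R w)) (at u within ?I)"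
        by (rule has_vector_derivative_diff)
      then show "(?g has_derivative (\<lambda>h. h *\<^sub>R (S *\<^sub>R v c (\<tau> u) - S *\<^sub>R w))) (at u within ?I)"
        by (simp add: has_vector_derivative_def)
      have "norm (S *\<^sub>R v c (\<tau> u) - S *\<^sub>R w) = S * norm (v c (\<tau> u) - w)"
        using S(1) by (simp add: scaleR_diff_right[symmetric])
      also have "\<dots> \<le> M * \<epsilon>"
        using near[OF uN] S \<epsilon> by (intro mult_mono) auto
      finally show "onorm (\<lambda>h. h *\<^sub>R (S *\<^sub>R v c (\<tau> u) - S *\<^sub>R w)) \<le> M * \<epsilon>"
        by (intro onorm_le) (simp add: mult.commute mult_left_mono)
    qed auto
    then show ?thesis by (simp add: algebra_simps)
  qed
  \<comment> \<open>First exit argument: the set \<open>Z\<close> of times outside \<open>U\<close>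
    is compact, so some \<open>u\<close> in it is closest to \<open>t0\<close>. The estimate up to
    \<open>u\<close> bounds the displacement by less than \<open>r / 2\<close>, which puts
    \<open>\<tau> u\<close> back into \<open>U\<close>. Times on both sides of \<open>t0\<close> are
    treated at once.\<close>
  have stay: "\<tau> s \<in> U" if s: "s \<in> {0..1}" "\<bar>s - t0\<bar> \<le> \<bar>t - t0\<bar>" for s
  proof (rule ccontr)
    assume "\<tau> s \<notin> U"
    have cm: "continuous_map (top_of_set {0..1}) X \<tau>" using \<tau> unfolding rescaled_curve_def by simp
    have closed: "closed {u \<in> {0..1}. \<tau> u \<in> C}" if "closedin X C" for C
      using closedin_continuous_map_preimage[OF cm that] closedin_closed_trans
      by (metis closed_atLeastAtMost topspace_euclidean_subtopology)
    define Z where "Z = {u \<in> {0..1}. \<tau> u \<in> topspace X - U} \<inter> cball t0 \<bar>t - t0\<bar>"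
    have "compact Z" unfolding Z_def
      using closed[of "topspace X - U"] U by (intro closed_Int_compact) auto
    have memZ: "u \<in> Z \<longleftrightarrow> u \<in> {0..1} \<and> \<bar>u - t0\<bar> \<le> \<bar>t - t0\<bar> \<and> \<tau> u \<notin> U" for u
      using cm unfolding Z_def continuous_map_def by (auto simp: dist_real_def abs_minus_commute)
    have "Z \<noteq> {}" using memZ s \<open>\<tau> s \<notin> U\<close> by blast
    then obtain u where u: "u \<in> Z" and min: "\<And>u'. u' \<in> Z \<Longrightarrow> \<bar>u - t0\<bar> \<le> \<bar>u' - t0\<bar>"
    proof -
      have "continuous_on Z (\<lambda>u. \<bar>u - t0\<bar>)" by (intro continuous_intros)
      with \<open>compact Z\<close> \<open>Z \<noteq> {}\<close> show ?thesis
        using that continuous_attains_inf[of Z "\<lambda>u. \<bar>u - t0\<bar>"] by meson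
    qed
    have ne: "u \<noteq> t0" using u t0U memZ by blast
    have "\<tau> u' \<in> N" if "u' \<in> open_segment t0 u" for u'
    proof -
      have "\<bar>u' - t0\<bar> < \<bar>u - t0\<bar>" "u' \<in> {0..1}"
        using that u memZ[of u] t(1) by (auto simp: open_segment_eq_real_ivl split: if_splits)
      moreover have "\<bar>u - t0\<bar> \<le> \<bar>t - t0\<bar>" using u memZ by blast
      ultimately have "u' \<in> Z" if "\<tau> u' \<notin> U" using that memZ by simp
      then show ?thesis using min[of u'] \<open>\<bar>u' - t0\<bar> < \<bar>u - t0\<bar>\<close> UN by force
    qed
    moreover have "open_segment t0 u \<subseteq> {0..1}"
      using u memZ[of u] t(1) by (auto simp: open_segment_eq_real_ivl split: if_splits)
    ultimately have "open_segment t0 u \<subseteq> {u \<in> {0..1}. \<tau> u \<in> N}" by blast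
    \<comment> \<open>Before the exit time the curve is in \<open>U\<close>, hence in
      \<open>N\<close>; closedness of \<open>N\<close> in \<open>X\<close> adds the exit time
      itself.\<close>
    then have "closure (open_segment t0 u) \<subseteq> {u \<in> {0..1}. \<tau> u \<in> N}"
      using closed[OF N] by (rule closure_minimal)
    then have seg: "closed_segment t0 u \<subseteq> {u \<in> {0..1}. \<tau> u \<in> N}" using ne by simp
    then have "norm (?\<phi> (\<tau> u) - ?\<phi> (\<tau> t0) - ((u - t0) * S) *\<^sub>R w) \<le> M * \<epsilon> * \<bar>u - t0\<bar>"
      by (intro est) auto
    moreover have "norm (((u - t0) * S) *\<^sub>R w) \<le> M * norm w * \<bar>u - t0\<bar>"
      using S by (simp add: abs_mult mult.commute mult.left_commute mult_left_mono mult_right_mono)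
    ultimately have "norm (?\<phi> (\<tau> u) - ?\<phi> (\<tau> t0)) \<le> M * (norm w + \<epsilon>) * \<bar>u - t0\<bar>"
      using norm_triangle_sub[of "?\<phi> (\<tau> u) - ?\<phi> (\<tau> t0)" "((u - t0) * S) *\<^sub>R w"]
      by (simp add: algebra_simps)
    also have "\<dots> \<le> M * (norm w + \<epsilon>) * \<bar>t - t0\<bar>"
      using u memZ S \<epsilon> by (intro mult_left_mono) auto
    finally have "dist (?\<phi> (\<tau> t0)) (?\<phi> (\<tau> u)) < r / 2"
      using small by (simp add: dist_norm norm_minus_commute)
    then have "?\<phi> (\<tau> u) \<in> ball q r"
      using start(2) dist_triangle[of q "?\<phi> (\<tau> u)" "?\<phi> (\<tau> t0)"] by simp
    moreover have "\<tau> u \<in> chart_dom c" using seg unfolding N_def by auto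
    ultimately show False using u memZ unfolding U_def by blast
  qed
  have "\<tau> ` closed_segment t0 t \<subseteq> N"
  proof
    fix x assume "x \<in> \<tau> ` closed_segment t0 t"
    then obtain s where s: "s \<in> closed_segment t0 t" "x = \<tau> s" by blast
    then have "s \<in> {0..1}" "\<bar>s - t0\<bar> \<le> \<bar>t - t0\<bar>"
      using t by (auto simp: closed_segment_eq_real_ivl split: if_splits)
    then show "x \<in> N" using stay s UN by blast
  qed
  then show ?thesis using est t(2) unfolding N_def by auto
qed

section \<open>Limits of integral curves\<close>

text \<open>The estimate only involves the values of the curve at two times, so it survives pointwise
  limits; no uniform convergence of the curves is needed.\<close>

lemma rescaled_curve_limit:
  assumes X: "Hausdorff_space X" and charts: "\<And>c. c \<in> \<A> \<Longrightarrow> is_chart X c"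
    and cover: "topspace X = (\<Union>c\<in>\<A>. chart_dom c)"
    and v: "\<And>c. c \<in> \<A> \<Longrightarrow> continuous_on (chart_image c) (v c \<circ> chart_inv c)"
    and F: "F \<noteq> bot"
    and curves: "eventually (\<lambda>i. rescaled_curve X \<A> v (S i) (\<tau> i) \<and> 0 \<le> S i \<and> S i \<le> M) F"
    and S: "(S \<longlongrightarrow> T) F" and \<tau>: "\<And>t. t \<in> {0..1} \<Longrightarrow> limitin X (\<lambda>i. \<tau> i t) (\<sigma> t) F"
  shows "rescaled_curve X \<A> v T \<sigma>"
proof -
  have "0 \<le> M"
    using eventually_happens[OF curves] F by auto
  \<comment> \<open>This is differentiability of the limit at \<open>t0\<close> in epsilon-delta
    form. The radius \<delta> is chosen from the field near \<open>\<sigma> t0\<close> and from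
    \<open>M\<close>, before any curve of the family is considered.\<close>
  have near: "\<exists>\<delta>>0. \<forall>t\<in>{0..1}. \<bar>t - t0\<bar> \<le> \<delta> \<longrightarrow> \<sigma> t \<in> chart_dom c \<and>
      norm (chart_map c (\<sigma> t) - chart_map c (\<sigma> t0) - (t - t0) *\<^sub>R (T *\<^sub>R v c (\<sigma> t0))) \<le> \<epsilon> * \<bar>t - t0\<bar>"
    if t0: "t0 \<in> {0..1}" and c: "c \<in> \<A>" "\<sigma> t0 \<in> chart_dom c" and \<epsilon>: "0 < \<epsilon>" for t0 c \<epsilon>
  proof -
    let ?\<phi> = "chart_map c"
    define q where "q = ?\<phi> (\<sigma> t0)"
    define w where "w = v c (\<sigma> t0)"
    \<comment> \<open>The estimate has error factor \<open>M * \<eta>\<close>, which must not exceed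
      \<epsilon>; adding 1 avoids division by zero when \<open>M = 0\<close>.\<close>
    define \<eta> where "\<eta> = \<epsilon> / (M + 1)"
    have \<eta>: "0 < \<eta>" using \<epsilon> \<open>0 \<le> M\<close> unfolding \<eta>_def by simp
    have M\<eta>: "M * \<eta> \<le> \<epsilon>" using \<epsilon> \<open>0 \<le> M\<close> unfolding \<eta>_def by (simp add: field_simps)
    note ch = charts[OF c(1)]
    have inv: "chart_inv c (?\<phi> x) = x" if "x \<in> chart_dom c" for x
      using chart_inj_on[OF ch] that by simp
    obtain r1 where r1: "r1 > 0" "cball q r1 \<inter> half_space \<subseteq> chart_image c"
      using chart_ball_subset_image[OF ch c(2)] unfolding q_def by blast
    have "\<exists>d>0. \<forall>y\<in>chart_image c. dist y q < d \<longrightarrow> dist ((v c \<circ> chart_inv c) y) ((v c \<circ> chart_inv c) q) < \<eta>"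
      using v[OF c(1)] c(2) \<eta> unfolding continuous_on_iff q_def by blast
    then obtain d where d: "d > 0"
      "\<And>y. y \<in> chart_image c \<Longrightarrow> dist y q < d \<Longrightarrow> dist ((v c \<circ> chart_inv c) y) ((v c \<circ> chart_inv c) q) < \<eta>"
      by blast
    define r where "r = min r1 (d / 2)"
    have r: "0 < r" "cball q r \<inter> half_space \<subseteq> chart_image c"
      using r1 d(1) unfolding r_def by auto
    have vnear: "norm (v c x - w) \<le> \<eta>" if "x \<in> chart_dom c" "?\<phi> x \<in> cball q r" for x
    proof -
      have "dist (?\<phi> x) q < d" using that(2) d(1) unfolding r_def by (auto simp: dist_commute)
      then have "dist (v c x) w < \<eta>"
        using d(2)[of "?\<phi> x"] that(1) inv[OF that(1)] inv[OF c(2)] unfolding q_def w_def by simp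
      then show ?thesis by (simp add: dist_norm)
    qed
    define B where "B = M * (norm w + \<eta>)"
    have B: "0 \<le> B" using \<open>0 \<le> M\<close> \<eta> unfolding B_def by simp
    \<comment> \<open>Then \<open>(B + 1) * \<delta>\<close> is \<open>r / 4\<close>, strictly below
      the \<open>r / 2\<close> that the estimate allows.\<close>
    define \<delta> where "\<delta> = r / (4 * (B + 1))"
    have \<delta>: "0 < \<delta>" using r B unfolding \<delta>_def by simp
    have lim0: "eventually (\<lambda>i. \<tau> i t0 \<in> chart_dom c) F" "((\<lambda>i. ?\<phi> (\<tau> i t0)) \<longlongrightarrow> q) F"
      using chart_limitin[OF ch \<tau>[OF t0] c(2)] unfolding q_def by auto
    have start: "eventually (\<lambda>i. ?\<phi> (\<tau> i t0) \<in> ball q (r / 2)) F"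
      using lim0(2) r(1) by (intro topological_tendstoD) auto
    show ?thesis
    proof (intro exI[of _ \<delta>] conjI ballI impI)
      fix t :: real assume t: "t \<in> {0..1}" "\<bar>t - t0\<bar> \<le> \<delta>"
      have "B * \<bar>t - t0\<bar> \<le> (B + 1) * \<delta>"
        using t(2) B by (intro mult_mono) auto
      also have "\<dots> < r / 2" using r(1) B unfolding \<delta>_def by (simp add: field_simps add_pos_nonneg)
      finally have small: "M * (norm w + \<eta>) * \<bar>t - t0\<bar> < r / 2" unfolding B_def .
      have ev: "eventually (\<lambda>i. \<tau> i t \<in> {x \<in> chart_dom c. ?\<phi> x \<in> cball q r} \<and>
        norm (?\<phi> (\<tau> i t) - ?\<phi> (\<tau> i t0) - ((t - t0) * S i) *\<^sub>R w) \<le> M * \<eta> * \<bar>t - t0\<bar>) F"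
        using curves lim0(1) start
      proof eventually_elim
        case (elim i)
        then have curve: "rescaled_curve X \<A> v (S i) (\<tau> i)" "0 \<le> S i" "S i \<le> M"
          and "\<tau> i t0 \<in> chart_dom c" "?\<phi> (\<tau> i t0) \<in> ball q (r / 2)" by auto
        then show ?case
          using rescaled_curve_estimate[OF X c(1) ch curve r(2) vnear t0 t(1) small] by auto
      qed
      then have "eventually (\<lambda>i. \<tau> i t \<in> {x \<in> chart_dom c. ?\<phi> x \<in> cball q r}) F"
        by (rule eventually_mono) blast
      \<comment> \<open>The limit point cannot escape from the chart because this set is closed in
        \<open>X\<close>; only now may the coordinates at time \<open>t\<close> be passed to the
        limit.\<close>
      then have "\<sigma> t \<in> {x \<in> chart_dom c. ?\<phi> x \<in> cball q r}"
        using limitin_closedin[OF \<tau>[OF t(1)] chart_cball_closedin[OF ch X r(2)]] F by blast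
      then show D: "\<sigma> t \<in> chart_dom c" by blast
      have "((\<lambda>i. norm (?\<phi> (\<tau> i t) - ?\<phi> (\<tau> i t0) - ((t - t0) * S i) *\<^sub>R w)) \<longlongrightarrow>
          norm (?\<phi> (\<sigma> t) - q - ((t - t0) * T) *\<^sub>R w)) F"
        by (intro tendsto_intros lim0(2) S chart_limitin(2)[OF ch \<tau>[OF t(1)] D])
      then have "norm (?\<phi> (\<sigma> t) - q - ((t - t0) * T) *\<^sub>R w) \<le> M * \<eta> * \<bar>t - t0\<bar>"
        by (rule tendsto_upperbound[OF _ _ F]) (use ev in \<open>auto elim: eventually_mono\<close>)
      also have "\<dots> \<le> \<epsilon> * \<bar>t - t0\<bar>" using M\<eta> by (rule mult_right_mono) simp
      finally show "norm (?\<phi> (\<sigma> t) - ?\<phi> (\<sigma> t0) - (t - t0) *\<^sub>R (T *\<^sub>R v c (\<sigma> t0))) \<le> \<epsilon> * \<bar>t - t0\<bar>"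
        unfolding q_def w_def by simp
    qed (fact \<delta>)
  qed
  have deriv: "((chart_map c \<circ> \<sigma>) has_vector_derivative T *\<^sub>R v c (\<sigma> t0)) (at t0 within {0..1})"
    if "t0 \<in> {0..1}" "c \<in> \<A>" "\<sigma> t0 \<in> chart_dom c" for t0 c
    unfolding has_vector_derivative_def has_derivative_within_alt
  proof (intro conjI allI impI)
    show "bounded_linear (\<lambda>h. h *\<^sub>R (T *\<^sub>R v c (\<sigma> t0)))" by (rule bounded_linear_scaleR_left)
    fix \<epsilon> :: real assume "0 < \<epsilon>"
    from near[OF that this] obtain \<delta> where "\<delta> > 0" and
      "\<forall>t\<in>{0..1}. \<bar>t - t0\<bar> \<le> \<delta> \<longrightarrow> \<sigma> t \<in> chart_dom c \<and>
      norm (chart_map c (\<sigma> t) - chart_map c (\<sigma> t0) - (t - t0) *\<^sub>R (T *\<^sub>R v c (\<sigma> t0))) \<le> \<epsilon> * \<bar>t - t0\<bar>"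
      by blast
    then show "\<exists>d>0. \<forall>y\<in>{0..1}. norm (y - t0) < d \<longrightarrow>
       norm ((chart_map c \<circ> \<sigma>) y - (chart_map c \<circ> \<sigma>) t0 - (y - t0) *\<^sub>R (T *\<^sub>R v c (\<sigma> t0))) \<le> \<epsilon> * norm (y - t0)"
      by (intro exI[of _ \<delta>]) auto
  qed
  \<comment> \<open>A pointwise limit of continuous curves need not be continuous. Here continuity
    follows from the derivative just found: near \<open>t0\<close> the limit stays in one chart, and
    its coordinates are continuous at \<open>t0\<close>.\<close>
  have "continuous_map (top_of_set {0..1}) X \<sigma>"
    unfolding continuous_map_def
  proof (intro conjI allI impI)
    show "\<sigma> \<in> topspace (top_of_set {0..1}) \<rightarrow> topspace X"
      using \<tau> unfolding limitin_def by simp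
    fix U assume U: "openin X U"
    show "openin (top_of_set {0..1}) {t \<in> topspace (top_of_set {0..1}). \<sigma> t \<in> U}"
      unfolding openin_euclidean_subtopology_iff
    proof (intro conjI ballI)
      fix t0 :: real assume "t0 \<in> {t \<in> topspace (top_of_set {0..1}). \<sigma> t \<in> U}"
      then have t0: "t0 \<in> {0..1}" "\<sigma> t0 \<in> U" by auto
      then obtain c where c: "c \<in> \<A>" "\<sigma> t0 \<in> chart_dom c"
        using cover U openin_subset by blast
      note ch = charts[OF c(1)]
      have "openin (subtopology X (chart_dom c)) (U \<inter> chart_dom c)"
        using U by (simp add: openin_subtopology_Int)
      then have "openin (top_of_set (chart_image c))
          {y \<in> chart_image c. chart_inv c y \<in> U \<inter> chart_dom c}"
        using openin_continuous_map_preimage[OF chart_inv_continuous_map[OF ch]] by fastforce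
      moreover have "chart_map c (\<sigma> t0) \<in> {y \<in> chart_image c. chart_inv c y \<in> U \<inter> chart_dom c}"
        using t0 c chart_inj_on[OF ch] by simp
      ultimately obtain r where r: "0 < r"
        "\<And>y. y \<in> chart_image c \<Longrightarrow> dist y (chart_map c (\<sigma> t0)) < r \<Longrightarrow> chart_inv c y \<in> U"
        unfolding openin_euclidean_subtopology_iff by blast
      have "continuous (at t0 within {0..1}) (chart_map c \<circ> \<sigma>)"
        using deriv[OF t0(1) c] has_vector_derivative_continuous by blast
      then obtain d where d: "0 < d"
        "\<And>t. t \<in> {0..1} \<Longrightarrow> dist t t0 < d \<Longrightarrow> dist (chart_map c (\<sigma> t)) (chart_map c (\<sigma> t0)) < r"
        using r(1) unfolding continuous_within_eps_delta by auto
      obtain \<delta> where \<delta>: "\<delta> > 0" "\<And>t. t \<in> {0..1} \<Longrightarrow> \<bar>t - t0\<bar> \<le> \<delta> \<Longrightarrow> \<sigma> t \<in> chart_dom c"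
        using near[OF t0(1) c zero_less_one] by blast
      have "\<sigma> t \<in> U" if "t \<in> {0..1}" "dist t t0 < min d \<delta>" for t
      proof -
        have "\<sigma> t \<in> chart_dom c" using that \<delta>(2) by (simp add: dist_real_def)
        then show ?thesis using r(2)[of "chart_map c (\<sigma> t)"] d(2) that chart_inj_on[OF ch] by simp
      qed
      then show "\<exists>e>0. \<forall>x'\<in>{0..1}. dist x' t0 < e \<longrightarrow> x' \<in> {t \<in> topspace (top_of_set {0..1}). \<sigma> t \<in> U}"
        using d(1) \<delta>(1) by (intro exI[of _ "min d \<delta>"]) auto
    qed auto
  qed
  then show ?thesis using deriv unfolding rescaled_curve_def by blast
qed

text \<open>In a chart the curve has derivative zero and is locally constant, so the times at which
  it has its initial value form a nonempty clopen subset of the connected unit interval.\<close>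

lemma rescaled_curve_zero:
  assumes X: "Hausdorff_space X" and charts: "\<And>c. c \<in> \<A> \<Longrightarrow> is_chart X c"
    and cover: "topspace X = (\<Union>c\<in>\<A>. chart_dom c)"
    and \<sigma>: "rescaled_curve X \<A> v 0 \<sigma>"
  shows "\<sigma> 1 = \<sigma> 0"
proof -
  have cm: "continuous_map (top_of_set {0..1}) X \<sigma>" using \<sigma> unfolding rescaled_curve_def by simp
  let ?E = "{t \<in> {0..1}. \<sigma> t \<in> {\<sigma> 0}}"
  have "\<sigma> 0 \<in> topspace X" using cm unfolding continuous_map_def by auto
  then have cl: "closedin (top_of_set {0..1}) ?E"
    using closedin_continuous_map_preimage[OF cm, of "{\<sigma> 0}"] X by (simp add: closedin_Hausdorff_sing_eq)
  have "openin (top_of_set {0..1}) ?E"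
  proof (subst openin_subopen, rule)
    fix t0 :: real assume "t0 \<in> ?E"
    then have t0: "t0 \<in> {0..1}" "\<sigma> t0 = \<sigma> 0" by auto
    then obtain c where c: "c \<in> \<A>" "\<sigma> t0 \<in> chart_dom c"
      using cover \<open>\<sigma> 0 \<in> topspace X\<close> by auto
    note ch = charts[OF c(1)]
    have "openin (top_of_set {0..1}) {t \<in> {0..1}. \<sigma> t \<in> chart_dom c}"
      using openin_continuous_map_preimage[OF cm, of "chart_dom c"] ch unfolding is_chart_def by simp
    then obtain e where e: "0 < e" "ball t0 e \<inter> {0..1} \<subseteq> {t \<in> {0..1}. \<sigma> t \<in> chart_dom c}"
      using t0 c(2) unfolding openin_contains_ball by blast
    let ?J = "ball t0 e \<inter> {0..1}"
    have "\<sigma> t = \<sigma> 0" if t: "t \<in> ?J" for t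
    proof -
      have der: "((chart_map c \<circ> \<sigma>) has_derivative (\<lambda>h. 0)) (at s within ?J)" if "s \<in> ?J" for s
      proof -
        have "((chart_map c \<circ> \<sigma>) has_vector_derivative 0 *\<^sub>R v c (\<sigma> s)) (at s within {0..1})"
          using \<sigma> c(1) that e(2) unfolding rescaled_curve_def by blast
        then show ?thesis
          by (simp add: has_vector_derivative_def has_derivative_subset)
      qed
      have "\<exists>k. \<forall>s\<in>?J. (chart_map c \<circ> \<sigma>) s = k"
        by (rule has_derivative_zero_constant[OF convex_Int[OF convex_ball convex_real_interval(5)] der])
      then have "chart_map c (\<sigma> t) = chart_map c (\<sigma> t0)" using t t0(1) e(1) by auto
      moreover have "\<sigma> t \<in> chart_dom c" using t e(2) by blast
      ultimately show ?thesis using c(2) chart_inj_on[OF ch] t0(2) inj_onD by metis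
    qed
    moreover have "openin (top_of_set {0..1}) ?J"
      using openin_open_Int[OF open_ball, of "{0..1}" t0 e] by (simp add: Int_commute)
    ultimately show "\<exists>T. openin (top_of_set {0..1}) T \<and> t0 \<in> T \<and> T \<subseteq> ?E"
      using t0(1) e(1) by (intro exI[of _ ?J]) auto
  qed
  then have "?E = {} \<or> ?E = {0..1}"
    using cl connected_clopen[of "{0..1::real}"] by auto
  moreover have "0 \<in> ?E" by simp
  ultimately have "?E = {0..1}" by blast
  then have "1 \<in> ?E" by (rule ssubst) simp
  then show ?thesis by simp
qed

section \<open>Growth of Lyapunov functions along integral curves\<close>

text \<open>A derivative within a set is determined if the set contains arbitrarily short steps from
  the point along every basis direction. Positive steps stay in the half-space even from a boundary
  point, because \<open>normal_dir\<close> is itself a basis vector.\<close>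

lemma frechet_derivative_unique_half_space:
  fixes f :: "'e::euclidean_space \<Rightarrow> 'c::real_normed_vector"
  assumes S: "openin (top_of_set half_space) S" "x \<in> S"
    and "(f has_derivative f') (at x within S)" "(f has_derivative f'') (at x within S)"
  shows "f' = f''"
proof (rule frechet_derivative_unique_within[OF assms(3,4)])
  fix i :: 'e and e :: real assume i: "i \<in> Basis" and e: "e > 0"
  obtain r where r: "0 < r" "ball x r \<inter> half_space \<subseteq> S"
    using S unfolding openin_contains_ball by blast
  define d where "d = min e r / 2"
  have d: "0 < d" "d < e" "d < r" using e r(1) unfolding d_def by auto
  have "normal_dir \<in> (Basis :: 'e set)"
    unfolding normal_dir_def by (rule someI_ex) (use nonempty_Basis in blast)
  then have "0 \<le> i \<bullet> normal_dir" using i by (simp add: inner_Basis)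
  moreover have "x \<in> half_space" using S openin_imp_subset by blast
  ultimately have "x + d *\<^sub>R i \<in> half_space"
    using d(1) by (simp add: half_space_def inner_add_left)
  moreover have "x + d *\<^sub>R i \<in> ball x r" using d i by (simp add: dist_norm)
  ultimately have "x + d *\<^sub>R i \<in> S" using r(2) by blast
  then show "\<exists>d. 0 < \<bar>d\<bar> \<and> \<bar>d\<bar> < e \<and> x + d *\<^sub>R i \<in> S"
    using d by (intro exI[of _ d]) auto
qed

text \<open>One local extension \<open>g\<close> computes the derivatives at all nearby points of
  \<open>S\<close>, so the derivative within \<open>S\<close> inherits the continuity of that of
  \<open>g\<close>.\<close>

lemma smooth_on_has_derivative:
  assumes "smooth_on S f" "x \<in> S"
  obtains T g where "open T" "x \<in> T" "\<And>k. Ck_on k T g"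
    "\<And>y. y \<in> S \<inter> T \<Longrightarrow> (f has_derivative frechet_derivative g (at y)) (at y within S)"
proof -
  obtain T g where T: "open T" "x \<in> T" "\<forall>k. Ck_on k T g" "\<forall>y\<in>S \<inter> T. g y = f y"
    using assms unfolding smooth_on_def by blast
  have "(f has_derivative frechet_derivative g (at y)) (at y within S)" if y: "y \<in> S \<inter> T" for y
  proof -
    have "(g has_derivative frechet_derivative g (at y)) (at y)"
      using T(3)[rule_format, of "Suc 0"] y by (simp add: frechet_derivative_works[symmetric])
    then have "(g has_derivative frechet_derivative g (at y)) (at y within S \<inter> T)"
      by (rule has_derivative_at_withinI)
    then have "(f has_derivative frechet_derivative g (at y)) (at y within S \<inter> T)"
      by (rule has_derivative_transform[OF y, rotated]) (simp add: T(4))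
    moreover have "at y within S \<inter> T = at y within S"
      using y T(1) by (intro at_within_nhd[of _ T]) auto
    ultimately show ?thesis by simp
  qed
  then show thesis using that T by blast
qed

lemma continuous_on_frechet_derivative_half_space:
  fixes f :: "'e::euclidean_space \<Rightarrow> 'c::real_normed_vector"
  assumes S: "openin (top_of_set half_space) S" and f: "smooth_on S f" and w: "continuous_on S w"
  shows "continuous_on S (\<lambda>y. frechet_derivative f (at y within S) (w y))"
proof (rule continuous_on_eq_continuous_within[THEN iffD2], rule)
  fix x assume x: "x \<in> S"
  obtain T g where T: "open T" "x \<in> T" "\<And>k. Ck_on k T g"
    and D: "\<And>y. y \<in> S \<inter> T \<Longrightarrow> (f has_derivative frechet_derivative g (at y)) (at y within S)"
    using smooth_on_has_derivative[OF f x] by blast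
  \<comment> \<open>\<open>Ck_on\<close> gives continuity of the derivative only in a fixed
    direction, so the varying direction \<open>w y\<close> is expanded in the basis.\<close>
  have eq: "(\<Sum>b\<in>Basis. (w y \<bullet> b) *\<^sub>R frechet_derivative g (at y) b)
      = frechet_derivative f (at y within S) (w y)" if y: "y \<in> S \<inter> T" for y
  proof -
    have "(f has_derivative frechet_derivative f (at y within S)) (at y within S)"
      using D[OF y] frechet_derivative_works differentiable_def by blast
    then have e: "frechet_derivative f (at y within S) = frechet_derivative g (at y)"
      using frechet_derivative_unique_half_space[OF S] D y by blast
    have lin: "linear (frechet_derivative g (at y))"
      using D[OF y] has_derivative_linear by blast
    have "frechet_derivative g (at y) (w y)
        = frechet_derivative g (at y) (\<Sum>b\<in>Basis. (w y \<bullet> b) *\<^sub>R b)"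
      by (simp add: euclidean_representation)
    then show ?thesis unfolding e by (simp add: linear_sum[OF lin] linear_scale[OF lin])
  qed
  have "continuous_on T (\<lambda>y. frechet_derivative g (at y) b)" for b
    using T(3)[of "Suc 0"] by simp
  then have "continuous_on (S \<inter> T) (\<lambda>y. \<Sum>b\<in>Basis. (w y \<bullet> b) *\<^sub>R frechet_derivative g (at y) b)"
    using w by (intro continuous_intros) (auto intro: continuous_on_subset)
  then have "continuous_on (S \<inter> T) (\<lambda>y. frechet_derivative f (at y within S) (w y))"
    by (rule continuous_on_eq) (rule eq)
  then have "continuous (at x within S \<inter> T) (\<lambda>y. frechet_derivative f (at y within S) (w y))"
    using x T(2) by (simp add: continuous_on_eq_continuous_within)
  moreover have "at x within S \<inter> T = at x within S"
    by (rule at_within_nhd[OF T(2,1)]) auto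
  ultimately show "continuous (at x within S) (\<lambda>y. frechet_derivative f (at y within S) (w y))"
    by simp
qed

lemma chart_continuous_on_vimage:
  fixes h :: "'e::euclidean_space \<Rightarrow> 'b::topological_space"
  assumes c: "is_chart X c" and h: "continuous_on (chart_image c) h" and "open V"
  shows "openin X {x \<in> chart_dom c. h (chart_map c x) \<in> V}"
proof -
  obtain W where W: "open W" "W \<inter> chart_image c = h -` V \<inter> chart_image c"
    using h \<open>open V\<close> unfolding continuous_on_open_invariant by blast
  then have "{x \<in> chart_dom c. h (chart_map c x) \<in> V} = {x \<in> chart_dom c. chart_map c x \<in> W}"
    by auto
  then show ?thesis using chart_openin_vimage[OF c W(1)] by simp
qed

lemma smooth_map_continuous_map:
  fixes f :: "'a \<Rightarrow> 'b::real_normed_vector"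
  assumes charts: "\<And>c. c \<in> \<A> \<Longrightarrow> is_chart X c" and cover: "topspace X = (\<Union>c\<in>\<A>. chart_dom c)"
    and f: "smooth_map \<A> f"
  shows "continuous_map X euclidean f"
  unfolding continuous_map_def
proof (intro conjI allI impI)
  fix V :: "'b set" assume "openin euclidean V"
  then have "openin X {x \<in> chart_dom c. (f \<circ> chart_inv c) (chart_map c x) \<in> V}" if "c \<in> \<A>" for c
    using f that unfolding smooth_map_def
    by (intro chart_continuous_on_vimage charts smooth_on_imp_continuous_on) (auto simp del: o_apply)
  then have "openin X (\<Union>c\<in>\<A>. {x \<in> chart_dom c. (f \<circ> chart_inv c) (chart_map c x) \<in> V})"
    by blast
  moreover have "{x \<in> chart_dom c. (f \<circ> chart_inv c) (chart_map c x) \<in> V}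
      = {x \<in> chart_dom c. f x \<in> V}" if "c \<in> \<A>" for c
    using chart_inj_on[OF charts[OF that]] by auto
  then have "(\<Union>c\<in>\<A>. {x \<in> chart_dom c. (f \<circ> chart_inv c) (chart_map c x) \<in> V})
      = {x \<in> topspace X. f x \<in> V}"
    unfolding cover by blast
  ultimately show "openin X {x \<in> topspace X. f x \<in> V}" by simp
qed simp

text \<open>In a chart \<open>df(v)\<close> is continuous and positive, so it exceeds half its value
  at a point on a neighbourhood of that point; compactness leaves finitely many such bounds. Asking
  for just one chart around each point avoids comparing \<open>dir_deriv\<close> between
  charts.\<close>

lemma lyapunov_lower_bound:
  assumes charts: "\<And>c. c \<in> \<A> \<Longrightarrow> is_chart X c" and cover: "topspace X = (\<Union>c\<in>\<A>. chart_dom c)"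
    and compact: "compact_space X"
    and v: "\<And>c. c \<in> \<A> \<Longrightarrow> continuous_on (chart_image c) (v c \<circ> chart_inv c)"
    and f: "lyapunov \<A> v f"
  shows "\<exists>m>0. \<forall>x\<in>topspace X. \<exists>c\<in>\<A>. x \<in> chart_dom c \<and> m \<le> dir_deriv v f c x"
proof -
  define P where "P m x \<longleftrightarrow> (\<exists>c\<in>\<A>. x \<in> chart_dom c \<and> m \<le> dir_deriv v f c x)" for m x
  define \<U> where "\<U> = {U. openin X U \<and> (\<exists>m>0. \<forall>x\<in>U. P m x)}"
  have "\<exists>U\<in>\<U>. p \<in> U" if "p \<in> topspace X" for p
  proof -
    obtain c where c: "c \<in> \<A>" "p \<in> chart_dom c" using \<open>p \<in> topspace X\<close> unfolding cover by blast
    define h where "h = (\<lambda>y. frechet_derivative (f \<circ> chart_inv c) (at y within chart_image c)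
      ((v c \<circ> chart_inv c) y))"
    have "continuous_on (chart_image c) h"
      unfolding h_def
      using charts[OF c(1)] f v c(1) unfolding is_chart_def lyapunov_def smooth_map_def
      by (intro continuous_on_frechet_derivative_half_space) auto
    then have op: "openin X {x \<in> chart_dom c. h (chart_map c x) \<in> {h (chart_map c p) / 2<..}}"
      by (intro chart_continuous_on_vimage charts c(1)) auto
    have h: "h (chart_map c x) = dir_deriv v f c x" if "x \<in> chart_dom c" for x
      using that chart_inj_on[OF charts[OF c(1)]] unfolding h_def dir_deriv_def by simp
    then have pos: "0 < h (chart_map c p)" using f c unfolding lyapunov_def by simp
    then have "0 < h (chart_map c p) / 2" by simp
    moreover have "P (h (chart_map c p) / 2) x"
      if "x \<in> {x \<in> chart_dom c. h (chart_map c x) \<in> {h (chart_map c p) / 2<..}}" for x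
      unfolding P_def using that by (intro bexI[OF _ c(1)]) (auto simp: h)
    ultimately have "{x \<in> chart_dom c. h (chart_map c x) \<in> {h (chart_map c p) / 2<..}} \<in> \<U>"
      unfolding \<U>_def using op by blast
    then show ?thesis using c(2) pos by (rule_tac bexI) simp_all
  qed
  then have "topspace X \<subseteq> \<Union>\<U>" by blast
  moreover have "\<forall>U\<in>\<U>. openin X U" unfolding \<U>_def by blast
  ultimately obtain \<F> where \<F>: "finite \<F>" "\<F> \<subseteq> \<U>" "topspace X \<subseteq> \<Union>\<F>"
    using compact unfolding compact_space_alt by meson
  have "\<exists>m>0. \<forall>x\<in>\<Union>\<F>. P m x"
    using \<F>(1,2)
  proof (induction \<F> rule: finite_induct)
    case empty
    show ?case by (intro exI[of _ 1]) auto
  next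
    case (insert U \<F>)
    obtain m1 where "0 < m1" "\<forall>x\<in>\<Union>\<F>. P m1 x" using insert by auto
    moreover obtain m2 where "0 < m2" "\<forall>x\<in>U. P m2 x" using insert.prems unfolding \<U>_def by auto
    moreover have "P (min m1 m2) x" if "P m1 x \<or> P m2 x" for x
      using that unfolding P_def by (auto simp: min_le_iff_disj)
    ultimately show ?case by (intro exI[of _ "min m1 m2"] conjI ballI) auto
  qed
  then show ?thesis using \<F>(3) unfolding P_def by blast
qed

text \<open>Chain rule in a chart. The times spent in the chart domain are relatively open in
  \<open>I\<close>, so derivatives within them and within \<open>I\<close> agree.\<close>

lemma integral_curve_has_derivative:
  fixes f :: "'a \<Rightarrow> real"
  assumes c: "c \<in> \<A>" "is_chart X c" and f: "smooth_map \<A> f"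
    and \<sigma>: "integral_curve X \<A> v I \<sigma>" and t: "t \<in> I" "\<sigma> t \<in> chart_dom c"
  shows "((f \<circ> \<sigma>) has_real_derivative dir_deriv v f c (\<sigma> t)) (at t within I)"
proof -
  have cm: "continuous_map (top_of_set I) X \<sigma>" using \<sigma> unfolding integral_curve_def by simp
  let ?J = "{s \<in> I. \<sigma> s \<in> chart_dom c}"
  have "openin (top_of_set I) ?J"
    using openin_continuous_map_preimage[OF cm, of "chart_dom c"] c(2) unfolding is_chart_def by simp
  then obtain W where W: "open W" "?J = I \<inter> W" unfolding openin_open by blast
  have at: "at t within ?J = at t within I"
    using W t by (intro at_within_nhd[of _ W]) auto
  let ?y = "(chart_map c \<circ> \<sigma>) t" and ?g = "f \<circ> chart_inv c"
  have "((chart_map c \<circ> \<sigma>) has_derivative (\<lambda>h. h *\<^sub>R v c (\<sigma> t))) (at t within ?J)"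
    using \<sigma> t c(1) unfolding integral_curve_def has_vector_derivative_def at by blast
  moreover have "(?g has_derivative frechet_derivative ?g (at ?y within chart_image c))
      (at ?y within chart_image c)"
  proof -
    have "smooth_on (chart_image c) ?g" "?y \<in> chart_image c"
      using f c(1) t(2) unfolding smooth_map_def by auto
    then have "?g differentiable (at ?y within chart_image c)"
      unfolding differentiable_def by (meson IntI smooth_on_has_derivative)
    then show ?thesis by (simp add: frechet_derivative_works)
  qed
  ultimately have D: "((?g \<circ> (chart_map c \<circ> \<sigma>)) has_derivative
      frechet_derivative ?g (at ?y within chart_image c) \<circ> (\<lambda>h. h *\<^sub>R v c (\<sigma> t))) (at t within ?J)"
    by (intro diff_chain_within) (auto intro: has_derivative_subset)
  have lin: "linear (frechet_derivative ?g (at ?y within chart_image c))"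
    using \<open>(?g has_derivative _) _\<close> has_derivative_linear by blast
  have "frechet_derivative ?g (at ?y within chart_image c) \<circ> (\<lambda>h. h *\<^sub>R v c (\<sigma> t))
      = (*) (dir_deriv v f c (\<sigma> t))"
    using linear_scale[OF lin] by (intro ext) (simp add: dir_deriv_def mult.commute)
  with D have "((?g \<circ> (chart_map c \<circ> \<sigma>)) has_real_derivative dir_deriv v f c (\<sigma> t)) (at t within ?J)"
    by (simp add: has_field_derivative_def)
  then have "((f \<circ> \<sigma>) has_real_derivative dir_deriv v f c (\<sigma> t)) (at t within ?J)"
    by (rule has_field_derivative_transform_within[where d = 1])
      (use t chart_inj_on[OF c(2)] in auto)
  then show ?thesis unfolding at .
qed

text \<open>The mean value theorem, with the chart chosen separately at each time. It bounds
  durations when \<open>f\<close> is bounded, and for \<open>m > 0\<close> it gives strict increase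
  along the curve.\<close>

lemma integral_curve_growth:
  fixes f :: "'a \<Rightarrow> real"
  assumes charts: "\<And>c. c \<in> \<A> \<Longrightarrow> is_chart X c" and f: "smooth_map \<A> f"
    and m: "\<And>x. x \<in> topspace X \<Longrightarrow> \<exists>c\<in>\<A>. x \<in> chart_dom c \<and> m \<le> dir_deriv v f c x"
    and \<sigma>: "integral_curve X \<A> v {a..b} \<sigma>" and st: "a \<le> s" "s \<le> t" "t \<le> b"
  shows "m * (t - s) \<le> f (\<sigma> t) - f (\<sigma> s)"
proof (cases "s = t")
  case False
  have "\<exists>D\<ge>m. ((f \<circ> \<sigma>) has_real_derivative D) (at u within {s..t})" if u: "u \<in> {s..t}" for u
  proof -
    have u': "u \<in> {a..b}" using u st by auto
    then have "\<sigma> u \<in> topspace X"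
      using \<sigma> unfolding integral_curve_def continuous_map_def by auto
    then obtain c where c: "c \<in> \<A>" "\<sigma> u \<in> chart_dom c" "m \<le> dir_deriv v f c (\<sigma> u)"
      using m by blast
    have "((f \<circ> \<sigma>) has_real_derivative dir_deriv v f c (\<sigma> u)) (at u within {a..b})"
      by (rule integral_curve_has_derivative[OF c(1) charts[OF c(1)] f \<sigma> u' c(2)])
    then show ?thesis
      using c(3) st by (meson DERIV_subset atLeastatMost_subset_iff)
  qed
  then obtain D where D: "\<And>u. u \<in> {s..t} \<Longrightarrow> m \<le> D u \<and> ((f \<circ> \<sigma>) has_real_derivative D u) (at u within {s..t})"
    by metis
  then obtain u where "u \<in> {s<..<t}" "(f \<circ> \<sigma>) t - (f \<circ> \<sigma>) s = D u * (t - s)"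
    using mvt_simple[of s t "f \<circ> \<sigma>" "\<lambda>u. (*) (D u)"] False st(2) unfolding has_field_derivative_def
    by auto
  moreover have "m * (t - s) \<le> D u * (t - s)"
    using D[of u] \<open>u \<in> {s<..<t}\<close> st(2) by (intro mult_right_mono) auto
  ultimately show ?thesis by simp
qed simp

section \<open>Trajectories\<close>

lemma traversing_continuous_on:
  assumes "traversing X \<A> v" "c \<in> \<A>"
  shows "continuous_on (chart_image c) (v c \<circ> chart_inv c)"
proof (rule smooth_on_imp_continuous_on)
  have "smooth_vector_field \<A> v" using assms(1) unfolding traversing_def by (rule conjunct1)
  then have "\<forall>c\<in>\<A>. smooth_on (chart_image c) (v c \<circ> chart_inv c)"
    unfolding smooth_vector_field_def by (rule conjunct1)
  then show "smooth_on (chart_image c) (v c \<circ> chart_inv c)" using assms(2) by (rule bspec)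
qed

lemma integral_curve_const:
  assumes "x \<in> topspace X"
  shows "integral_curve X \<A> v {t} (\<lambda>t. x)"
proof -
  \<comment> \<open>Over a one-point interval the limit in the derivative condition is along the
    trivial filter and holds vacuously.\<close>
  have "at t within {t} = bot" by (simp add: at_within_def)
  then show ?thesis
    using assms by (simp add: integral_curve_def has_vector_derivative_def has_derivative_def
        is_interval_connected_1 bounded_linear_scaleR_left)
qed

lemma trajectory_self:
  assumes "x \<in> topspace X"
  shows "x \<in> trajectory X \<A> v x"
  unfolding trajectory_def using integral_curve_const[OF assms, of \<A> v 0] by blast

lemma traversing_trajectory_cases:
  assumes "traversing X \<A> v" "x \<in> topspace X" "y \<in> trajectory X \<A> v x"
  obtains "y = x" | a b \<sigma> s t where "integral_curve X \<A> v {a..b} \<sigma>"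
    "s \<in> {a..b}" "t \<in> {a..b}" "x = \<sigma> s" "y = \<sigma> t" "\<sigma> ` {a..b} = trajectory X \<A> v x"
proof -
  consider "trajectory X \<A> v x = {x}" |
    a b \<sigma> where "integral_curve X \<A> v {a..b} \<sigma>" "\<sigma> ` {a..b} = trajectory X \<A> v x"
    using assms(1,2) unfolding traversing_def by blast
  then show thesis
  proof cases
    case 1
    then show ?thesis using assms(3) that(1) by blast
  next
    case 2
    moreover obtain s t where "s \<in> {a..b}" "t \<in> {a..b}" "x = \<sigma> s" "y = \<sigma> t"
      using 2(2) assms(3) trajectory_self[OF assms(2)] by (metis imageE)
    ultimately show ?thesis using that(2) by blast
  qed
qed

text \<open>If one integral curve sweeps out the whole trajectory of \<open>x\<close>, it also
  passes through \<open>y\<close>, so that trajectory is contained in the trajectory of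
  \<open>y\<close>. In particular \<open>x\<close> lies on the latter, and exchanging the points
  gives the other inclusion.\<close>

lemma traversing_trajectory_eq:
  assumes trav: "traversing X \<A> v" and x: "x \<in> topspace X" and y: "y \<in> trajectory X \<A> v x"
  shows "y \<in> topspace X" "trajectory X \<A> v y = trajectory X \<A> v x"
proof -
  have sub: "y \<in> topspace X \<and> trajectory X \<A> v x \<subseteq> trajectory X \<A> v y"
    if "x \<in> topspace X" "y \<in> trajectory X \<A> v x" for x y
    using trav that
  proof (cases rule: traversing_trajectory_cases)
    case (2 a b \<sigma> s t)
    have "\<sigma> t \<in> topspace X"
      using 2(1,3) unfolding integral_curve_def continuous_map_def by auto
    moreover have "z \<in> trajectory X \<A> v (\<sigma> t)" if "z \<in> \<sigma> ` {a..b}" for z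
      using 2(1,3) that unfolding trajectory_def by blast
    ultimately show ?thesis using 2 by auto
  qed (use that in auto)
  show Y: "y \<in> topspace X" using sub[OF x y] by simp
  have "x \<in> trajectory X \<A> v y" using sub[OF x y] trajectory_self[OF x] by blast
  then show "trajectory X \<A> v y = trajectory X \<A> v x"
    using sub[OF x y] sub[OF Y] by blast
qed

section \<open>Passing between integral curves and rescaled curves\<close>

lemma integral_curve_rescale:
  assumes \<sigma>: "integral_curve X \<A> v {a..b} \<sigma>" and st: "a \<le> s" "s \<le> t" "t \<le> b"
  shows "rescaled_curve X \<A> v (t - s) (\<lambda>u. \<sigma> (s + u * (t - s)))"
proof -
  let ?h = "\<lambda>u. s + u * (t - s)"
  have h: "?h ` {0..1} \<subseteq> {a..b}"
  proof
    fix y assume "y \<in> ?h ` {0..1}"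
    then obtain u where u: "0 \<le> u" "u \<le> 1" "y = ?h u" by auto
    have "0 \<le> u * (t - s)" "u * (t - s) \<le> 1 * (t - s)"
      using u st by (simp, intro mult_right_mono) auto
    then show "y \<in> {a..b}" using u(3) st by auto
  qed
  have "continuous_map (top_of_set {0..1}) (top_of_set {a..b}) ?h"
    using h by (auto simp: continuous_map_in_subtopology intro!: continuous_intros)
  then have "continuous_map (top_of_set {0..1}) X (\<sigma> \<circ> ?h)"
    using \<sigma> continuous_map_compose unfolding integral_curve_def by blast
  moreover have "((chart_map c \<circ> (\<sigma> \<circ> ?h)) has_vector_derivative (t - s) *\<^sub>R v c (\<sigma> (?h u))) (at u within {0..1})"
    if u: "u \<in> {0..1}" "c \<in> \<A>" "\<sigma> (?h u) \<in> chart_dom c" for u c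
  proof -
    have "(?h has_vector_derivative (t - s)) (at u within {0..1})"
      by (auto intro!: derivative_eq_intros simp: has_vector_derivative_def)
    moreover have "((chart_map c \<circ> \<sigma>) has_vector_derivative v c (\<sigma> (?h u))) (at (?h u) within ?h ` {0..1})"
      using \<sigma> u h has_vector_derivative_within_subset unfolding integral_curve_def by blast
    ultimately have "(((chart_map c \<circ> \<sigma>) \<circ> ?h) has_vector_derivative (t - s) *\<^sub>R v c (\<sigma> (?h u))) (at u within {0..1})"
      by (rule vector_diff_chain_within)
    then show ?thesis by (simp only: comp_assoc)
  qed
  ultimately show ?thesis unfolding rescaled_curve_def by (simp add: o_def)
qed

lemma rescaled_curve_integral_curve:
  assumes \<tau>: "rescaled_curve X \<A> v S \<tau>" and S: "0 < S"
  shows "integral_curve X \<A> v {0..S} (\<lambda>t. \<tau> (t / S))"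
proof -
  let ?h = "\<lambda>t. t / S"
  have h: "?h ` {0..S} \<subseteq> {0..1}" using S by auto
  have "continuous_map (top_of_set {0..S}) (top_of_set {0..1}) ?h"
    using h S by (auto simp: continuous_map_in_subtopology intro!: continuous_intros)
  then have "continuous_map (top_of_set {0..S}) X (\<tau> \<circ> ?h)"
    using \<tau> continuous_map_compose unfolding rescaled_curve_def by blast
  moreover have "((chart_map c \<circ> (\<tau> \<circ> ?h)) has_vector_derivative v c (\<tau> (?h u))) (at u within {0..S})"
    if u: "u \<in> {0..S}" "c \<in> \<A>" "\<tau> (?h u) \<in> chart_dom c" for u c
  proof -
    have "(?h has_vector_derivative (1 / S)) (at u within {0..S})"
      using S by (auto intro!: derivative_eq_intros simp: has_vector_derivative_def)
    moreover have "((chart_map c \<circ> \<tau>) has_vector_derivative S *\<^sub>R v c (\<tau> (?h u))) (at (?h u) within ?h ` {0..S})"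
      using \<tau> u h has_vector_derivative_within_subset unfolding rescaled_curve_def by blast
    ultimately have "(((chart_map c \<circ> \<tau>) \<circ> ?h) has_vector_derivative (1 / S) *\<^sub>R S *\<^sub>R v c (\<tau> (?h u))) (at u within {0..S})"
      by (rule vector_diff_chain_within)
    then show ?thesis using S by (simp add: comp_assoc)
  qed
  ultimately show ?thesis unfolding integral_curve_def by (simp add: o_def is_interval_cc)
qed

text \<open>Points of a product topology are extensional functions, so curves have to be restricted
  to the unit interval without losing their properties.\<close>

lemma rescaled_curve_cong:
  assumes "\<And>t. t \<in> {0..1} \<Longrightarrow> \<tau> t = \<tau>' t" "rescaled_curve X \<A> v S \<tau>"
  shows "rescaled_curve X \<A> v S \<tau>'"
proof -
  have "continuous_map (top_of_set {0..1}) X \<tau>'"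
    using assms unfolding rescaled_curve_def by (auto elim!: continuous_map_eq)
  moreover have "((chart_map c \<circ> \<tau>') has_vector_derivative S *\<^sub>R v c (\<tau>' t)) (at t within {0..1})"
    if t: "t \<in> {0..1}" "c \<in> \<A>" "\<tau>' t \<in> chart_dom c" for t c
  proof (rule has_vector_derivative_transform[OF t(1)])
    show "((chart_map c \<circ> \<tau>) has_vector_derivative S *\<^sub>R v c (\<tau>' t)) (at t within {0..1})"
      using assms t unfolding rescaled_curve_def by metis
  qed (simp add: assms(1))
  ultimately show ?thesis unfolding rescaled_curve_def by blast
qed

section \<open>Closedness of the trajectory relation and the Hausdorff property\<close>

lemma closedin_trajectory_relation:
  assumes man: "smooth_manifold_with_boundary X \<A>" and compact: "compact_space X"
    and trav: "traversing X \<A> v" and f: "lyapunov \<A> v f"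
  shows "closedin (prod_topology X X)
    {(x, y). x \<in> topspace X \<and> y \<in> topspace X \<and> trajectory X \<A> v x = trajectory X \<A> v y}"
    (is "closedin _ ?R")
proof -
  have X: "Hausdorff_space X" and charts: "\<And>c. c \<in> \<A> \<Longrightarrow> is_chart X c"
    and cover: "topspace X = (\<Union>c\<in>\<A>. chart_dom c)"
    using man unfolding smooth_manifold_with_boundary_def by auto
  have v: "continuous_on (chart_image c) (v c \<circ> chart_inv c)" if "c \<in> \<A>" for c
    using traversing_continuous_on[OF trav that] .
  have fs: "smooth_map \<A> f" using f unfolding lyapunov_def by simp
  obtain m where m: "0 < m"
    "\<And>x. x \<in> topspace X \<Longrightarrow> \<exists>c\<in>\<A>. x \<in> chart_dom c \<and> m \<le> dir_deriv v f c x"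
    using lyapunov_lower_bound[OF charts cover compact v f] by blast
  have "compact (f ` topspace X)"
    using image_compactin[of X "topspace X" euclidean f] compact
      smooth_map_continuous_map[OF charts cover fs] unfolding compact_space_def by simp
  then obtain B where B: "\<And>x. x \<in> topspace X \<Longrightarrow> \<bar>f x\<bar> \<le> B"
    using compact_imp_bounded[of "f ` topspace X"] unfolding bounded_iff by auto
  \<comment> \<open>Along a curve \<open>f\<close> changes by at most \<open>2 * B\<close> and grows
    at rate at least \<open>m\<close>, so no duration exceeds \<open>2 * B / m\<close>.\<close>
  define M where "M = max 0 (2 * B / m)"
  define Y where "Y = prod_topology (top_of_set {0..M}) (product_topology (\<lambda>i::real. X) {0..1})"
  define C where "C = {z \<in> topspace Y. rescaled_curve X \<A> v (fst z) (snd z)}"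
  have ev: "continuous_map Y X (\<lambda>z. snd z t)" if "t \<in> {0..1}" for t
    unfolding Y_def using that
    by (intro continuous_map_compose[OF continuous_map_snd, unfolded o_def]
        continuous_map_product_coordinates)
  have "Y closure_of C \<subseteq> C"
  proof
    fix z assume z: "z \<in> Y closure_of C"
    then have zY: "z \<in> topspace Y" by (simp add: in_closure_of)
    \<comment> \<open>The trace on \<open>C\<close> of the neighbourhoods of \<open>z\<close>: it is
      a proper filter since \<open>z\<close> is in the closure, and continuous maps converge along
      it to their value at \<open>z\<close>. So durations and values at each fixed time converge,
      which is all that \<open>rescaled_curve_limit\<close> asks for.\<close>
    define F where "F = inf (nhdsin Y z) (principal C)"
    have evF: "eventually P F" if "openin Y V" "z \<in> V" "\<And>y. y \<in> V \<Longrightarrow> y \<in> C \<Longrightarrow> P y" for P V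
      unfolding F_def eventually_inf_principal eventually_nhdsin using that by blast
    have "\<not> eventually (\<lambda>y. False) F"
      unfolding F_def eventually_inf_principal eventually_nhdsin
      using z unfolding in_closure_of by auto
    then have F: "F \<noteq> bot" by (simp add: trivial_limit_def)
    have lim: "limitin Z h (h z) F" if h: "continuous_map Y Z h" for Z :: "'z topology" and h
      unfolding limitin_def
    proof (intro conjI allI impI)
      show "h z \<in> topspace Z" using h zY unfolding continuous_map_def by auto
      fix U assume "openin Z U \<and> h z \<in> U"
      then show "eventually (\<lambda>y. h y \<in> U) F"
        using openin_continuous_map_preimage[OF h] zY
        by (intro evF[of "{y \<in> topspace Y. h y \<in> U}"]) auto
    qed
    have "continuous_map Y euclideanreal fst"
      unfolding Y_def using continuous_map_fst continuous_map_into_fulltopology by blast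
    then have "(fst \<longlongrightarrow> fst z) F" using lim by (metis limitin_canonical_iff)
    moreover have "limitin X (\<lambda>y. snd y t) (snd z t) F" if "t \<in> {0..1}" for t
      using lim[OF ev[OF that]] .
    moreover have "eventually (\<lambda>y. rescaled_curve X \<A> v (fst y) (snd y) \<and> 0 \<le> fst y \<and> fst y \<le> M) F"
      by (rule evF[OF openin_topspace zY]) (auto simp: C_def Y_def)
    ultimately have "rescaled_curve X \<A> v (fst z) (snd z)"
      by (intro rescaled_curve_limit[OF X charts cover v F])
    then show "z \<in> C" using zY unfolding C_def by simp
  qed
  then have "closedin Y C"
    using closure_of_subset_eq[of C Y] unfolding C_def by auto
  moreover have "compact_space Y"
    unfolding Y_def using compact
    by (simp add: compact_space_prod_topology compact_space_product_topology compact_space_subtopology)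
  ultimately have "compactin Y C" using closedin_compact_space by blast
  moreover have XX: "Hausdorff_space (prod_topology X X)"
    using X by (simp add: Hausdorff_space_prod_topology)
  ultimately have closed: "closedin (prod_topology X X) ((\<lambda>z. (snd z s, snd z t)) ` C)"
    if "s \<in> {0..1}" "t \<in> {0..1}" for s t
    using that ev by (intro compactin_imp_closedin image_compactin[of Y] continuous_map_pairedI) auto
  have ends_related: "(snd z s, snd z t) \<in> ?R" if z: "z \<in> C" and st: "(s = 0 \<and> t = 1) \<or> (s = 1 \<and> t = 0)" for z s t
  proof -
    obtain S \<tau> where [simp]: "z = (S, \<tau>)" by fastforce
    have \<tau>: "rescaled_curve X \<A> v S \<tau>" "0 \<le> S" using z unfolding C_def Y_def by auto
    then have top: "\<tau> u \<in> topspace X" if "u \<in> {0..1}" for u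
      using that unfolding rescaled_curve_def continuous_map_def by auto
    have "trajectory X \<A> v (\<tau> 0) = trajectory X \<A> v (\<tau> 1)"
    proof (cases "S = 0")
      case True
      then show ?thesis using rescaled_curve_zero[OF X charts cover, of v \<tau>] \<tau>(1) by simp
    next
      case False
      then have "integral_curve X \<A> v {0..S} (\<lambda>t. \<tau> (t / S))"
        using rescaled_curve_integral_curve[OF \<tau>(1)] \<tau>(2) by simp
      moreover have "\<tau> 0 \<in> (\<lambda>t. \<tau> (t / S)) ` {0..S}"
        using \<tau>(2) by (intro image_eqI[of _ _ 0]) auto
      moreover have "\<tau> 1 \<in> (\<lambda>t. \<tau> (t / S)) ` {0..S}"
        using \<tau>(2) False by (intro image_eqI[of _ _ S]) auto
      ultimately have "\<tau> 1 \<in> trajectory X \<A> v (\<tau> 0)" unfolding trajectory_def by blast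
      then show ?thesis using traversing_trajectory_eq(2)[OF trav top[of 0], of "\<tau> 1"] by simp
    qed
    then show ?thesis using st top by auto
  qed
  \<comment> \<open>Every piece of an integral curve, rescaled and restricted, is a point of
    \<open>C\<close>; the bound on durations is what puts it into \<open>Y\<close>.\<close>
  have forward: "(\<sigma> s, \<sigma> t) \<in> (\<lambda>z. (snd z 0, snd z 1)) ` C"
    if \<sigma>: "integral_curve X \<A> v {a..b} \<sigma>" and st: "a \<le> s" "s \<le> t" "t \<le> b" for \<sigma> a b s t
  proof -
    have top: "\<sigma> u \<in> topspace X" if "u \<in> {a..b}" for u
      using \<sigma> that unfolding integral_curve_def continuous_map_def by auto
    let ?\<tau> = "restrict (\<lambda>u. \<sigma> (s + u * (t - s))) {0..1}"
    have \<tau>: "rescaled_curve X \<A> v (t - s) ?\<tau>"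
      by (rule rescaled_curve_cong[OF _ integral_curve_rescale[OF \<sigma> st]]) simp
    have "m * (t - s) \<le> f (\<sigma> t) - f (\<sigma> s)"
      by (rule integral_curve_growth[OF charts fs m(2) \<sigma> st])
    also have "\<dots> \<le> 2 * B" using B[of "\<sigma> t"] B[of "\<sigma> s"] top st by fastforce
    finally have "t - s \<le> 2 * B / m" using m(1) by (simp add: field_simps)
    then have "t - s \<in> {0..M}" using st unfolding M_def by auto
    moreover have "?\<tau> \<in> {0..1} \<rightarrow> topspace X"
      using \<tau> unfolding rescaled_curve_def continuous_map_def by simp
    then have "?\<tau> \<in> topspace (product_topology (\<lambda>i. X) {0..1})"
      unfolding topspace_product_topology PiE_def o_def by (intro IntI restrict_extensional)
    ultimately have "(t - s, ?\<tau>) \<in> C" using \<tau> unfolding C_def Y_def by simp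
    then show ?thesis by (intro image_eqI[of _ _ "(t - s, ?\<tau>)"]) auto
  qed
  have diagonal: "(x, x) \<in> (\<lambda>z. (snd z 0, snd z 1)) ` C" if "x \<in> topspace X" for x
  proof -
    have "integral_curve X \<A> v {0..0} (\<lambda>t. x)"
      using integral_curve_const[OF that] by simp
    then show ?thesis using forward[of 0 0 "\<lambda>t. x" 0 0] by simp
  qed
  \<comment> \<open>Rescaled curves run forward in time only, so the symmetric relation needs both
    orders of the end points. One-point trajectories come from constant curves with
    \<open>S = 0\<close>.\<close>
  have "?R = (\<lambda>z. (snd z 0, snd z 1)) ` C \<union> (\<lambda>z. (snd z 1, snd z 0)) ` C" (is "_ = ?E")
  proof (intro equalityI subsetI)
    fix p assume "p \<in> ?R"
    then obtain x y where p: "p = (x, y)" and x: "x \<in> topspace X" and "y \<in> topspace X"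
      "trajectory X \<A> v x = trajectory X \<A> v y" by blast
    then have "y \<in> trajectory X \<A> v x" using trajectory_self by metis
    with trav x have "(x, y) \<in> (\<lambda>z. (snd z 0, snd z 1)) ` C \<or> (y, x) \<in> (\<lambda>z. (snd z 0, snd z 1)) ` C"
    proof (cases rule: traversing_trajectory_cases)
      case 1
      then show ?thesis using diagonal[OF x] by simp
    next
      case (2 a b \<sigma> s t)
      then show ?thesis
        using forward[OF 2(1), of s t] forward[OF 2(1), of t s] by (cases "s \<le> t") auto
    qed
    then show "p \<in> ?E" unfolding p by blast
  next
    fix p assume "p \<in> ?E"
    then show "p \<in> ?R" using ends_related[of _ 0 1] ends_related[of _ 1 0] by blast
  qed
  then show ?thesis using closed[of 0 1] closed[of 1 0] closedin_Un by simp
qed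

text \<open>The quotient map is closed, and closed continuous surjections carry normal Hausdorff
  spaces to normal Hausdorff spaces.\<close>

lemma Hausdorff_trajectory_space:
  assumes man: "smooth_manifold_with_boundary X \<A>" and compact: "compact_space X"
    and trav: "traversing X \<A> v" and f: "lyapunov \<A> v f"
  shows "Hausdorff_space (trajectory_space X \<A> v)"
proof -
  let ?q = "trajectory X \<A> v" and ?Q = "trajectory_space X \<A> v"
  let ?R = "{(x, y). x \<in> topspace X \<and> y \<in> topspace X \<and> ?q x = ?q y}"
  have X: "Hausdorff_space X" using man unfolding smooth_manifold_with_boundary_def by simp
  have q: "quotient_map X ?Q ?q" by (rule quotient_map_trajectory)
  have "closedin ?Q (?q ` C)" if C: "closedin X C" for C
  proof -
    have CX: "C \<subseteq> topspace X" using C closedin_subset by blast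
    \<comment> \<open>The union of the trajectories meeting \<open>C\<close> is the first projection
      of this set, and projecting along a compact factor is a closed map.\<close>
    have "closedin (prod_topology X X) (?R \<inter> topspace X \<times> C)"
      using closedin_trajectory_relation[OF assms] C
      by (intro closedin_Int) (auto simp: closedin_prod_Times_iff)
    then have "closedin X (fst ` (?R \<inter> topspace X \<times> C))"
      using closed_map_fst[OF compact, of X] unfolding closed_map_def by blast
    moreover have "fst ` (?R \<inter> topspace X \<times> C) = {x \<in> topspace X. ?q x \<in> ?q ` C}"
    proof (intro equalityI subsetI)
      fix x assume "x \<in> {x \<in> topspace X. ?q x \<in> ?q ` C}"
      then obtain y where "x \<in> topspace X" "y \<in> C" "?q x = ?q y" by blast
      then have "(x, y) \<in> ?R \<inter> topspace X \<times> C" using CX by blast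
      then show "x \<in> fst ` (?R \<inter> topspace X \<times> C)" by (rule image_eqI[rotated]) simp
    qed auto
    ultimately show ?thesis
      using q image_mono[OF CX, of ?q] unfolding quotient_map_closedin by simp
  qed
  then have "closed_map X ?Q ?q" unfolding closed_map_def by blast
  moreover have "normal_space X"
    using compact X compact_Hausdorff_or_regular_imp_normal_space by blast
  ultimately have "normal_space ?Q \<and> Hausdorff_space ?Q"
    using X quotient_imp_continuous_map[OF q] quotient_imp_surjective_map[OF q]
    by (intro normal_Hausdorff_space_closed_continuous_map_image)
  then show ?thesis ..
qed

section \<open>Embeddings and isotopies\<close>

text \<open>Both functions strictly increase with time along a curve through the two points, so they
  order the points alike. With \<open>f = g\<close> this gives injectivity on trajectories; with two
  functions it keeps their convex combinations injective there.\<close>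

lemma lyapunov_order_on_trajectory:
  assumes man: "smooth_manifold_with_boundary X \<A>" and compact: "compact_space X"
    and trav: "traversing X \<A> v" and f: "lyapunov \<A> v f" and g: "lyapunov \<A> v g"
    and xy: "x \<in> topspace X" "y \<in> topspace X" "trajectory X \<A> v x = trajectory X \<A> v y"
  shows "x = y \<or> (f x < f y \<and> g x < g y) \<or> (f y < f x \<and> g y < g x)"
proof -
  have charts: "\<And>c. c \<in> \<A> \<Longrightarrow> is_chart X c" and cover: "topspace X = (\<Union>c\<in>\<A>. chart_dom c)"
    using man unfolding smooth_manifold_with_boundary_def by auto
  have v: "continuous_on (chart_image c) (v c \<circ> chart_inv c)" if "c \<in> \<A>" for c
    using traversing_continuous_on[OF trav that] .
  have less: "h (\<sigma> s) < h (\<sigma> t)"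
    if h: "lyapunov \<A> v h" and \<sigma>: "integral_curve X \<A> v {a..b} \<sigma>" and st: "a \<le> s" "s < t" "t \<le> b"
    for h \<sigma> a b s t
  proof -
    obtain m where m: "0 < m"
      "\<And>x. x \<in> topspace X \<Longrightarrow> \<exists>c\<in>\<A>. x \<in> chart_dom c \<and> m \<le> dir_deriv v h c x"
      using lyapunov_lower_bound[OF charts cover compact v h] by blast
    have "m * (t - s) \<le> h (\<sigma> t) - h (\<sigma> s)"
      using h st unfolding lyapunov_def by (intro integral_curve_growth[OF charts _ m(2) \<sigma>]) auto
    moreover have "0 < m * (t - s)" using m(1) st by simp
    ultimately show ?thesis by linarith
  qed
  have "y \<in> trajectory X \<A> v x" using xy trajectory_self by metis
  with trav xy(1) show ?thesis
  proof (cases rule: traversing_trajectory_cases)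
    case (2 a b \<sigma> s t)
    then show ?thesis
      using less[OF f 2(1)] less[OF g 2(1)] by (cases s t rule: linorder_cases) auto
  qed simp
qed

text \<open>A continuous injection of a compact space into a Hausdorff space is a closed map, hence
  an embedding. Stating this for any continuous \<open>h\<close> that separates the points of each
  trajectory covers all stages of the isotopy; \<open>f\<close> supplies the Hausdorff
  property.\<close>

lemma trajectory_embedding:
  assumes man: "smooth_manifold_with_boundary X \<A>" and compact: "compact_space X"
    and trav: "traversing X \<A> v" and "lyapunov \<A> v f"
    and h: "continuous_map X euclideanreal h"
    and inj: "\<And>x y. x \<in> topspace X \<Longrightarrow> y \<in> topspace X \<Longrightarrow>
      trajectory X \<A> v x = trajectory X \<A> v y \<Longrightarrow> h x = h y \<Longrightarrow> x = y"
  shows "embedding_map X (alpha_target X \<A> v) (alpha X \<A> v h)"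
proof (rule injective_closed_imp_embedding_map)
  have alpha: "alpha X \<A> v h = (\<lambda>x. (trajectory X \<A> v x, h x))"
    by (rule ext) (simp add: alpha_def)
  show cm: "continuous_map X (alpha_target X \<A> v) (alpha X \<A> v h)"
    unfolding alpha using h quotient_imp_continuous_map[OF quotient_map_trajectory]
    by (rule continuous_map_pairedI[rotated])
  have "Hausdorff_space (alpha_target X \<A> v)"
    using Hausdorff_trajectory_space[OF assms(1-4)] by (simp add: Hausdorff_space_prod_topology)
  then show "closed_map X (alpha_target X \<A> v) (alpha X \<A> v h)"
    using T1_Spaces.continuous_imp_closed_map cm compact by blast
  show "inj_on (alpha X \<A> v h) (topspace X)"
    by (rule inj_onI) (auto simp: alpha_def intro: inj)
qed

theorem lemma3p1:
  fixes X :: "'a topology"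
    and \<A> :: "('a, 'e::euclidean_space) chart set"
    and v :: "('a, 'e) vfield"
    and f :: "'a \<Rightarrow> real"
  assumes "smooth_manifold_with_boundary X \<A>"
    and "compact_space X" and "connected_space X"
    and "traversing X \<A> v"
    and "lyapunov \<A> v f"
  shows "embedding_map X (alpha_target X \<A> v) (alpha X \<A> v f) \<and>
    (\<forall>\<beta> :: 'a set \<Rightarrow> real ^ 'N. smooth_traj_map X \<A> v \<beta> \<longrightarrow>
       smooth_map \<A> (map_prod \<beta> id \<circ> alpha X \<A> v f)) \<and>
    (\<forall>f1 f2. lyapunov \<A> v f1 \<and> lyapunov \<A> v f2 \<longrightarrow>
       isotopic_embeddings X (alpha_target X \<A> v) (alpha X \<A> v f1) (alpha X \<A> v f2))"
proof (intro conjI allI impI)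
  have charts: "\<And>c. c \<in> \<A> \<Longrightarrow> is_chart X c" and cover: "topspace X = (\<Union>c\<in>\<A>. chart_dom c)"
    using assms(1) unfolding smooth_manifold_with_boundary_def by auto
  have cont: "continuous_map X euclideanreal g" if "lyapunov \<A> v g" for g
    using that smooth_map_continuous_map[OF charts cover] unfolding lyapunov_def by blast
  note order = lyapunov_order_on_trajectory[OF assms(1,2,4)]
  note embedding = trajectory_embedding[OF assms(1,2,4,5)]
  show "embedding_map X (alpha_target X \<A> v) (alpha X \<A> v f)"
    using order[OF assms(5,5)] by (intro embedding cont assms(5)) fastforce
  show "smooth_map \<A> (map_prod \<beta> id \<circ> alpha X \<A> v f)" if "smooth_traj_map X \<A> v \<beta>"
    for \<beta> :: "'a set \<Rightarrow> real ^ 'N"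
    unfolding smooth_map_def
  proof
    fix c assume c: "c \<in> \<A>"
    have "smooth_on (chart_image c) (\<lambda>y. (\<beta> (trajectory X \<A> v (chart_inv c y)), f (chart_inv c y)))"
      using that assms(5) c
      unfolding smooth_traj_map_def smooth_traj_fun_def lyapunov_def smooth_map_def o_def
      by (intro smooth_on_vec_Pair) auto
    then show "smooth_on (chart_image c) (map_prod \<beta> id \<circ> alpha X \<A> v f \<circ> chart_inv c)"
      by (simp add: o_def alpha_def)
  qed
  fix f1 f2 assume L: "lyapunov \<A> v f1 \<and> lyapunov \<A> v f2"
  define g where "g s x = (1 - s) * f1 x + s * f2 x" for s x
  show "isotopic_embeddings X (alpha_target X \<A> v) (alpha X \<A> v f1) (alpha X \<A> v f2)"
    unfolding isotopic_embeddings_def homotopic_with_def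
  \<comment> \<open>The isotopy fixes the trajectory coordinate and moves the real coordinate
    linearly from \<open>f1\<close> to \<open>f2\<close>.\<close>
  proof (intro exI[of _ "\<lambda>(s, x). alpha X \<A> v (g s) x"] conjI ballI allI)
    let ?P = "prod_topology (top_of_set {0..1::real}) X"
    have "continuous_map ?P euclideanreal (\<lambda>p. f1 (snd p))" "continuous_map ?P euclideanreal (\<lambda>p. f2 (snd p))"
      using L by (auto intro!: continuous_map_compose[OF continuous_map_snd, unfolded o_def] cont)
    moreover have "continuous_map ?P euclideanreal fst"
      using continuous_map_fst continuous_map_into_fulltopology by blast
    ultimately have "continuous_map ?P euclideanreal (\<lambda>p. g (fst p) (snd p))"
      unfolding g_def by (intro continuous_intros)
    moreover have "continuous_map ?P (trajectory_space X \<A> v) (\<lambda>p. trajectory X \<A> v (snd p))"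
      by (intro continuous_map_compose[OF continuous_map_snd, unfolded o_def]
          quotient_imp_continuous_map quotient_map_trajectory)
    ultimately show "continuous_map ?P (alpha_target X \<A> v) (\<lambda>(s, x). alpha X \<A> v (g s) x)"
      unfolding alpha_def case_prod_beta by (intro continuous_map_pairedI)
    fix s :: real assume s: "s \<in> {0..1}"
    have "embedding_map X (alpha_target X \<A> v) (alpha X \<A> v (g s))"
    proof (rule embedding)
      show "continuous_map X euclideanreal (g s)"
        unfolding g_def using L by (intro continuous_intros cont) auto
      fix x y assume xy: "x \<in> topspace X" "y \<in> topspace X" "trajectory X \<A> v x = trajectory X \<A> v y"
        and eq: "g s x = g s y"
      \<comment> \<open>For \<open>s < 1\<close> the \<open>f1\<close> term is strictly monotone and
        the \<open>f2\<close> term weakly; at \<open>s = 1\<close> only \<open>f2\<close> remains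
        and gives strictness.\<close>
      have less: "g s x < g s y" if "f1 x < f1 y" "f2 x < f2 y" for x y
      proof (cases "s = 1")
        case False
        then have "(1 - s) * f1 x < (1 - s) * f1 y" using that s by simp
        moreover have "s * f2 x \<le> s * f2 y" using that s by (intro mult_left_mono) auto
        ultimately show ?thesis unfolding g_def by linarith
      qed (use that in \<open>simp add: g_def\<close>)
      show "x = y" using order[OF _ _ xy, of f1 f2] L less[of x y] less[of y x] eq by fastforce
    qed
    then show "embedding_map X (alpha_target X \<A> v) (\<lambda>x. case (s, x) of (s, x) \<Rightarrow> alpha X \<A> v (g s) x)"
      by (simp add: eta_contract_eq)
  qed (simp_all add: alpha_def g_def)
qed

end
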